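(* Let $Q(t)$ be the number in system at time $t$ in the FCFS $GI/GI/n$ queue $\mathcal{Q}$ with the initial conditions described in the context. For all $x>0$ and $t\ge 0$, $$P\bigl((Q(t)-n)^+>x\bigr)\le P\Bigl(\sup_{0\le s\le t}\Bigl(A(s)-\sum_{i=1}^n N_i(s)\Bigr)>x\Bigr).$$ If in addition $Q(t)$ converges weakly to a stationary distribution $Q(\infty)$ as $t\to\infty$, then for all $x>0$, $$P\bigl((Q(\infty)-n)^+>x\bigr)\le P\Bigl(\sup_{t\ge 0}\Bigl(A(t)-\sum_{i=1}^n N_i(t)\Bigr)>x\Bigr).$$
   Context: $n\ge1$ is an integer. $A$ and $S$ are nonnegative random variables with $E[A]<\infty$, $E[S]<\infty$ and $P(A=0)=P(S=0)=0$. For a nonnegative random variable $X$ with finite mean $E[X]>0$, $R(X)$ denotes a random variable with the residual life distribution of $X$: $P(R(X)>z)=(E[X])^{-1}\int_z^\infty P(X>y)\,dy$ for $z\ge0$. An equilibrium renewal process with renewal distribution $X$ is a counting process whose first inter-event time is distributed as $R(X)$ and whose subsequent inter-event times are i.i.d. distributed as $X$ (all inter-event times independent). All processes are right-continuous with left limits. $x^+=\max(x,0)$. $N_1(t),\dots,N_n(t)$ are i.i.d. equilibrium renewal processes with renewal distribution $S$; $A(t)$ is an equilibrium renewal process with renewal distribution $A$; $A(\cdot),N_1(\cdot),\dots,N_n(\cdot)$ are mutually independent. $\mathcal{Q}$ is the first-come-first-served (FCFS) $GI/GI/n$ queue ($n$ parallel servers) with inter-arrival times i.i.d. distributed as $A$,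 processing times i.i.d. distributed as $S$ (independent of the arrivals), and the following initial conditions: for $i=1,\dots,n$ a single job is initially being processed on server $i$, the initial processing times of these $n$ jobs are i.i.d. distributed as $R(S)$; there are zero jobs waiting in queue; the first inter-arrival time is distributed as $R(A)$, independent of the initial processing times of the jobs initially in system. "Number in system" means number in service plus number waiting in queue. *)

theory Defs
  imports "HOL-Probability.Probability"
begin

section \<open>Equilibrium renewal processes\<close>

definition same_law :: "'a measure \<Rightarrow> ('a \<Rightarrow> real) \<Rightarrow> 'p measure \<Rightarrow> ('p \<Rightarrow> real) \<Rightarrow> bool" where
  "same_law M Y P X \<longleftrightarrow>
     Y \<in> borel_measurable M \<and> distr M borel Y = distr P borel X"

text \<open>The tail formula at \<open>z = 0\<close> already forces \<open>R > 0\<close> almost surely when \<open>X\<close> is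
  nonnegative with finite positive mean.\<close>

definition residual_life :: "'a measure \<Rightarrow> ('a \<Rightarrow> real) \<Rightarrow> 'p measure \<Rightarrow> ('p \<Rightarrow> real) \<Rightarrow> bool" where
  "residual_life M R P X \<longleftrightarrow>
     R \<in> borel_measurable M \<and>
     (\<forall>z\<ge>0. measure M {\<omega> \<in> space M. R \<omega> > z} =
        (LBINT y:{z<..}. measure P {\<omega> \<in> space P. X \<omega> > y}) / (\<integral>\<omega>. X \<omega> \<partial>P))"

text \<open>\<open>T 0\<close> is the first inter-event time. Inter-event times are nonnegative at every point
  of the space, not just almost surely, so that all paths of the counting process below are
  right-continuous with left limits, up to a possible explosion (a null event).\<close>

definition equilibrium_interevent_times ::
    "'a measure \<Rightarrow> (nat \<Rightarrow> 'a \<Rightarrow> real) \<Rightarrow> 'p measure \<Rightarrow> ('p \<Rightarrow> real) \<Rightarrow> bool" where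
  "equilibrium_interevent_times M T P X \<longleftrightarrow>
     prob_space.indep_vars M (\<lambda>_. borel) T UNIV \<and>
     residual_life M (T 0) P X \<and>
     (\<forall>k\<ge>1. same_law M (T k) P X) \<and>
     (\<forall>k. \<forall>\<omega>\<in>space M. 0 \<le> T k \<omega>)"

definition event_time :: "(nat \<Rightarrow> 'a \<Rightarrow> real) \<Rightarrow> nat \<Rightarrow> 'a \<Rightarrow> real" where
  "event_time T k \<omega> = (\<Sum>j\<le>k. T j \<omega>)"

text \<open>If infinitely many events occur by time \<open>t\<close> (a null event), the value is \<open>0\<close>.\<close>

definition counting_process :: "(nat \<Rightarrow> 'a \<Rightarrow> real) \<Rightarrow> real \<Rightarrow> 'a \<Rightarrow> nat" where
  "counting_process T t \<omega> = card {k. event_time T k \<omega> \<le> t}"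

section \<open>The FCFS queue with n parallel servers\<close>

text \<open>Pathwise dynamics. Servers are \<open>0, \<dots>, n - 1\<close>; \<open>v i\<close> is the processing time of the job
  initially on server \<open>i\<close>; the \<open>k\<close>-th arriving job arrives at time \<open>a k\<close> and has processing
  time \<open>s k\<close>. \<open>free_time n v a s k i\<close> is the time at which server \<open>i\<close> has completed the
  initial job and all of the jobs \<open>0, \<dots>, k - 1\<close> that it serves. Under FCFS, job \<open>k\<close> is served by
  the first server to become free of the jobs ahead of it. The choice made among
  several idle servers does not affect the number in system.\<close>

definition next_server :: "nat \<Rightarrow> (nat \<Rightarrow> real) \<Rightarrow> nat" where
  "next_server n w = (LEAST i. i < n \<and> (\<forall>j<n. w i \<le> w j))"

primrec free_time ::
    "nat \<Rightarrow> (nat \<Rightarrow> real) \<Rightarrow> (nat \<Rightarrow> real) \<Rightarrow> (nat \<Rightarrow> real) \<Rightarrow> nat \<Rightarrow> nat \<Rightarrow> real" where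
  "free_time n v a s 0 = v"
| "free_time n v a s (Suc k) =
     (let w = free_time n v a s k; i = next_server n w
      in w(i := max (a k) (w i) + s k))"

definition start_time ::
    "nat \<Rightarrow> (nat \<Rightarrow> real) \<Rightarrow> (nat \<Rightarrow> real) \<Rightarrow> (nat \<Rightarrow> real) \<Rightarrow> nat \<Rightarrow> real" where
  "start_time n v a s k =
     (let w = free_time n v a s k in max (a k) (w (next_server n w)))"

definition number_in_service ::
    "nat \<Rightarrow> (nat \<Rightarrow> real) \<Rightarrow> (nat \<Rightarrow> real) \<Rightarrow> (nat \<Rightarrow> real) \<Rightarrow> real \<Rightarrow> nat" where
  "number_in_service n v a s t =
     card {i. i < n \<and> t < v i} +
     card {k. start_time n v a s k \<le> t \<and> t < start_time n v a s k + s k}"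

definition number_waiting ::
    "nat \<Rightarrow> (nat \<Rightarrow> real) \<Rightarrow> (nat \<Rightarrow> real) \<Rightarrow> (nat \<Rightarrow> real) \<Rightarrow> real \<Rightarrow> nat" where
  "number_waiting n v a s t = card {k. a k \<le> t \<and> t < start_time n v a s k}"

definition number_in_system ::
    "nat \<Rightarrow> (nat \<Rightarrow> real) \<Rightarrow> (nat \<Rightarrow> real) \<Rightarrow> (nat \<Rightarrow> real) \<Rightarrow> real \<Rightarrow> nat" where
  "number_in_system n v a s t = number_in_service n v a s t + number_waiting n v a s t"

text \<open>Primitives of the stochastic queue: inter-arrival times \<open>T\<close>, initial processing times
  \<open>V i\<close> for \<open>i < n\<close>, and processing times \<open>U\<close> of the arriving jobs.\<close>

definition GI_GI_n_primitives ::
    "nat \<Rightarrow> 'p measure \<Rightarrow> ('p \<Rightarrow> real) \<Rightarrow> ('p \<Rightarrow> real) \<Rightarrow> 'a measure \<Rightarrow>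
     (nat \<Rightarrow> 'a \<Rightarrow> real) \<Rightarrow> (nat \<Rightarrow> 'a \<Rightarrow> real) \<Rightarrow> (nat \<Rightarrow> 'a \<Rightarrow> real) \<Rightarrow> bool" where
  "GI_GI_n_primitives n P A S M T V U \<longleftrightarrow>
     equilibrium_interevent_times M T P A \<and>
     (\<forall>i<n. residual_life M (V i) P S) \<and>
     (\<forall>k. same_law M (U k) P S) \<and>
     prob_space.indep_vars M (\<lambda>_. borel) (case_sum T (case_sum V U)) (UNIV <+> ({..<n} <+> UNIV))"

definition queue_process ::
    "nat \<Rightarrow> (nat \<Rightarrow> 'a \<Rightarrow> real) \<Rightarrow> (nat \<Rightarrow> 'a \<Rightarrow> real) \<Rightarrow> (nat \<Rightarrow> 'a \<Rightarrow> real) \<Rightarrow> real \<Rightarrow> 'a \<Rightarrow> nat" where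
  "queue_process n T V U t \<omega> =
     number_in_system n (\<lambda>i. V i \<omega>) (\<lambda>k. event_time T k \<omega>) (\<lambda>k. U k \<omega>) t"

section \<open>The bounding renewal processes\<close>

text \<open>\<open>X\<close> are the inter-event times of \<open>A(\<cdot>)\<close> and \<open>Y i\<close>, for \<open>i < n\<close>, those of \<open>N\<close> number \<open>i + 1\<close>.
  Independence of all inter-event times expresses both that each process has
  independent inter-event times and that the \<open>n + 1\<close> processes are mutually independent.\<close>

definition independent_equilibrium_renewals ::
    "nat \<Rightarrow> 'p measure \<Rightarrow> ('p \<Rightarrow> real) \<Rightarrow> ('p \<Rightarrow> real) \<Rightarrow> 'b measure \<Rightarrow>
     (nat \<Rightarrow> 'b \<Rightarrow> real) \<Rightarrow> (nat \<Rightarrow> nat \<Rightarrow> 'b \<Rightarrow> real) \<Rightarrow> bool" where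
  "independent_equilibrium_renewals n P A S M X Y \<longleftrightarrow>
     equilibrium_interevent_times M X P A \<and>
     (\<forall>i<n. equilibrium_interevent_times M (Y i) P S) \<and>
     prob_space.indep_vars M (\<lambda>_. borel) (case_sum X (\<lambda>(i, k). Y i k)) (UNIV <+> ({..<n} \<times> UNIV))"

definition renewal_difference ::
    "nat \<Rightarrow> (nat \<Rightarrow> 'b \<Rightarrow> real) \<Rightarrow> (nat \<Rightarrow> nat \<Rightarrow> 'b \<Rightarrow> real) \<Rightarrow> real \<Rightarrow> 'b \<Rightarrow> real" where
  "renewal_difference n X Y t \<omega> =
     real (counting_process X t \<omega>) - (\<Sum>i<n. real (counting_process (Y i) t \<omega>))"

section \<open>Weak convergence as time tends to infinity\<close>

text \<open>The continuous-time version of \<^const>\<open>weak_conv_m\<close>, which covers sequences only.\<close>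

definition weak_conv_at_top :: "(real \<Rightarrow> real measure) \<Rightarrow> real measure \<Rightarrow> bool" where
  "weak_conv_at_top \<mu> \<pi> \<longleftrightarrow>
     (\<forall>y. isCont (cdf \<pi>) y \<longrightarrow> ((\<lambda>t. cdf (\<mu> t) y) \<longlongrightarrow> cdf \<pi> y) at_top)"

end

theory Submission
  imports Defs
begin

text \<open>
  The queue is compared, path by path, with \<open>n\<close> servers that never pause: a server that completes
  a service takes the first waiting job or, if none waits, starts an artificial service. The
  completions on server \<open>i\<close> are then the events of the renewal process \<open>N\<^sub>i\<close>, whatever the
  arrivals are. Listing the completions of all servers in the order of time gives a sequence of
  \<^emph>\<open>slots\<close>, and each job takes the first slot that is not before its arrival and not taken by an
  earlier job. Three facts give the bound.

  \<^item> Let each job have the same processing time in both systems. Then it starts in the queue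
    no later than in its slot (\<open>start_time_le_slot_time\<close>): at the time of the slot, the earlier jobs
    that are unfinished on the unpausing servers occupy at most the other \<open>n - 1\<close> of them, and in the
    queue these jobs have started no later. The queue never has more than \<open>n\<close> jobs in service,
    so \<open>(Q(t) - n)\<^sup>+\<close> is at most the number of jobs that have arrived and wait for a slot after
    \<open>t\<close>. All slots up to \<open>t\<close> after the last artificial service go to jobs, so this number is at
    most the number of arrivals minus the number of slots in a window \<open>[u, t]\<close> (\<open>excess_bound\<close>).

  \<^item> The processing time that a job receives in this construction is the next service time of the
    server whose completion it uses. Which server and which service that is depends only on other
    times. Hence the processing times are independent, have the law of \<open>S\<close>, and are independent
    of the arrivals and of the initial services (\<open>indep_primitives\<close>), so the queue built from the
    renewal processes has the law of the given queue.

  \<^item> Over \<open>[0, t]\<close>, an equilibrium renewal process has the same law as its time reversal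
    (\<open>counts_reversed\<close>), because the distance from \<open>0\<close> to the first event and the distance from
    the last event to \<open>t\<close> enter the joint density symmetrically. The reversal turns the windows
    \<open>[u, t]\<close> into the windows \<open>[0, t - u]\<close>.

  The bound at \<open>t\<close> is at most the bound for the supremum over all times, and this one survives
  the weak limit at the continuity points of the limit law, which suffice by right-continuity of
  distribution functions.
\<close>

section \<open>Service in the first-come-first-served queue\<close>

lemma next_server_min:
  assumes "n \<ge> 1"
  shows "next_server n w < n" and "j < n \<Longrightarrow> w (next_server n w) \<le> w j"
proof -
  have "\<exists>i<n. \<forall>j<n. w i \<le> w j"
  proof -
    have "Min (w ` {..<n}) \<in> w ` {..<n}"
      using assms by (intro Min_in) (auto simp: lessThan_empty_iff)
    then obtain i where "i < n" "w i = Min (w ` {..<n})" by auto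
    then show ?thesis by (auto intro!: exI[of _ i])
  qed
  from LeastI_ex[OF this]
  show "next_server n w < n" and "j < n \<Longrightarrow> w (next_server n w) \<le> w j"
    unfolding next_server_def by auto
qed

lemma next_server_cong:
  "(\<And>i. i < n \<Longrightarrow> w i = w' i) \<Longrightarrow> next_server n w = next_server n w'"
  unfolding next_server_def by (intro arg_cong[where f=Least] ext) auto

abbreviation serving where
  "serving n v a s k \<equiv> next_server n (free_time n v a s k)"

lemma free_time_Suc_serving:
  "free_time n v a s (Suc k) (serving n v a s k) = start_time n v a s k + s k"
  by (simp add: start_time_def Let_def)

lemma free_time_mono:
  assumes "\<And>k. 0 \<le> s k" "j \<le> k"
  shows "free_time n v a s j i \<le> free_time n v a s k i"
proof -
  have "free_time n v a s k i \<le> free_time n v a s (Suc k) i" for k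
    using assms(1)[of k] by (auto simp: Let_def max_def)
  from lift_Suc_mono_le[of "\<lambda>k. free_time n v a s k i", OF this assms(2)] show ?thesis .
qed

text \<open>A server starts a job only after it has completed everything assigned to it before, so the
  jobs in service at a given time occupy different servers.\<close>

lemma number_in_service_le:
  assumes n: "n \<ge> 1" and s: "\<And>k. 0 \<le> s k"
  shows "number_in_service n v a s t \<le> n"
proof -
  let ?B = "{i. i < n \<and> t < v i}"
  let ?C = "{k. start_time n v a s k \<le> t \<and> t < start_time n v a s k + s k}"
  let ?f = "serving n v a s"
  have start: "free_time n v a s k (?f k) \<le> start_time n v a s k" for k
    by (simp add: start_time_def Let_def)
  have later: "start_time n v a s j + s j \<le> start_time n v a s k" if "j < k" "?f j = ?f k" for j k
    using free_time_mono[where s=s and j="Suc j" and k=k and n=n and v=v and a=a and i="?f j", OF s]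
      free_time_Suc_serving[of n v a s j] start[of k] that by simp
  have inj: "inj_on ?f ?C"
  proof (rule inj_onI)
    fix j k assume "j \<in> ?C" "k \<in> ?C" "?f j = ?f k"
    then show "j = k" using later[of j k] later[of k j] by (cases j k rule: linorder_cases) auto
  qed
  have sub: "?f ` ?C \<subseteq> {..<n}" using next_server_min(1)[OF n] by auto
  have "v (?f k) \<le> start_time n v a s k" for k
    using free_time_mono[where s=s and j=0 and k=k and n=n and v=v and a=a and i="?f k", OF s] start[of k] by simp
  then have "?f k \<notin> ?B" if "k \<in> ?C" for k using that by (metis (no_types, lifting) mem_Collect_eq not_less order_trans)
  then have disj: "?B \<inter> ?f ` ?C = {}" by blast
  have fin: "finite (?f ` ?C)" using sub finite_subset by blast
  have "card ?B + card ?C = card ?B + card (?f ` ?C)" using card_image[OF inj] by simp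
  also have "\<dots> = card (?B \<union> ?f ` ?C)" using disj fin by (intro card_Un_disjoint[symmetric]) auto
  also have "\<dots> \<le> card {..<n}" using sub by (intro card_mono) auto
  finally show ?thesis by (simp add: number_in_service_def)
qed

section \<open>Servers that never pause\<close>

definition epoch :: "(nat \<Rightarrow> nat \<Rightarrow> real) \<Rightarrow> nat \<Rightarrow> nat \<Rightarrow> real" where
  "epoch y i m = (\<Sum>l\<le>m. y i l)"

text \<open>Slot \<open>r\<close> is the \<open>r\<close>-th completion when the completions of all servers are listed by time,
  simultaneous ones by server, and numbered from \<open>0\<close>. Server \<open>i\<close> has completed
  \<open>completions n y r i\<close> services before slot \<open>r\<close>. Its initial service is number \<open>0\<close>, so the service that begins at slot \<open>r\<close> has number
  \<open>Suc (completions n y r i)\<close> for the server \<open>i\<close> of that slot.\<close>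

primrec completions :: "nat \<Rightarrow> (nat \<Rightarrow> nat \<Rightarrow> real) \<Rightarrow> nat \<Rightarrow> nat \<Rightarrow> nat" where
  "completions n y 0 = (\<lambda>_. 0)"
| "completions n y (Suc r) =
     (let c = completions n y r; i = next_server n (\<lambda>j. epoch y j (c j)) in c(i := Suc (c i)))"

definition slot_server :: "nat \<Rightarrow> (nat \<Rightarrow> nat \<Rightarrow> real) \<Rightarrow> nat \<Rightarrow> nat" where
  "slot_server n y r = next_server n (\<lambda>j. epoch y j (completions n y r j))"

definition slot_time :: "nat \<Rightarrow> (nat \<Rightarrow> nat \<Rightarrow> real) \<Rightarrow> nat \<Rightarrow> real" where
  "slot_time n y r = epoch y (slot_server n y r) (completions n y r (slot_server n y r))"

definition slot_service :: "nat \<Rightarrow> (nat \<Rightarrow> nat \<Rightarrow> real) \<Rightarrow> nat \<Rightarrow> real" where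
  "slot_service n y r = y (slot_server n y r) (Suc (completions n y r (slot_server n y r)))"

text \<open>A slot that finds no arrived job waiting starts an artificial service, which is not counted.\<close>

primrec started :: "nat \<Rightarrow> (nat \<Rightarrow> real) \<Rightarrow> (nat \<Rightarrow> nat \<Rightarrow> real) \<Rightarrow> nat \<Rightarrow> nat" where
  "started n a y 0 = 0"
| "started n a y (Suc r) =
     (if a (started n a y r) \<le> slot_time n y r then Suc (started n a y r) else started n a y r)"

definition starts_at :: "nat \<Rightarrow> (nat \<Rightarrow> real) \<Rightarrow> (nat \<Rightarrow> nat \<Rightarrow> real) \<Rightarrow> nat \<Rightarrow> nat \<Rightarrow> bool" where
  "starts_at n a y k r \<longleftrightarrow> started n a y r = k \<and> a k \<le> slot_time n y r"

definition job_slot :: "nat \<Rightarrow> (nat \<Rightarrow> real) \<Rightarrow> (nat \<Rightarrow> nat \<Rightarrow> real) \<Rightarrow> nat \<Rightarrow> nat" where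
  "job_slot n a y k = (LEAST r. starts_at n a y k r)"

definition job_service :: "nat \<Rightarrow> (nat \<Rightarrow> real) \<Rightarrow> (nat \<Rightarrow> nat \<Rightarrow> real) \<Rightarrow> nat \<Rightarrow> real" where
  "job_service n a y k = slot_service n y (job_slot n a y k)"

declare completions.simps(2)[simp del]

lemma completions_Suc:
  "completions n y (Suc r) =
    (completions n y r)(slot_server n y r := Suc (completions n y r (slot_server n y r)))"
  by (simp add: completions.simps(2) Let_def slot_server_def)

lemma completions_mono: "q \<le> r \<Longrightarrow> completions n y q i \<le> completions n y r i"
  by (rule lift_Suc_mono_le[of "\<lambda>r. completions n y r i"]) (auto simp: completions_Suc)

lemma started_mono: "q \<le> r \<Longrightarrow> started n a y q \<le> started n a y r"
  by (rule lift_Suc_mono_le[of "started n a y"]) auto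

lemma starts_at_unique:
  assumes "starts_at n a y k q" "starts_at n a y k r"
  shows "q = r"
proof -
  have *: False if "starts_at n a y k q" "starts_at n a y k r" "q < r" for q r
    using that started_mono[of "Suc q" r n a y] by (auto simp: starts_at_def)
  show ?thesis using *[OF assms] *[OF assms(2,1)] by (cases q r rule: linorder_cases) auto
qed

lemma job_slot_eq: "starts_at n a y k r \<Longrightarrow> job_slot n a y k = r"
  unfolding job_slot_def by (rule Least_equality) (auto dest: starts_at_unique)

lemma started_less_iff:
  assumes "starts_at n a y k q"
  shows "k < started n a y r \<longleftrightarrow> q < r"
  using assms started_mono[of "Suc q" r n a y] started_mono[of r q n a y]
  by (cases "q < r") (auto simp: starts_at_def)

lemma starts_at_exists_less: "k < started n a y r \<Longrightarrow> \<exists>q<r. starts_at n a y k q"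
proof (induction r)
  case (Suc r)
  show ?case
  proof (cases "k < started n a y r")
    case True
    then show ?thesis using Suc.IH less_SucI by blast
  next
    case False
    with Suc.prems have "starts_at n a y k r"
      by (auto simp: starts_at_def less_Suc_eq split: if_splits)
    then show ?thesis by auto
  qed
qed simp

text \<open>The merged list of slots depends on the service times alone. The arrivals only decide
  which slots are taken by jobs.\<close>

locale service_paths =
  fixes n :: nat and y :: "nat \<Rightarrow> nat \<Rightarrow> real"
  assumes n: "n \<ge> 1"
    and y_nonneg: "\<And>i l. i < n \<Longrightarrow> 0 \<le> y i l"
begin

lemma slot_server_less: "slot_server n y r < n"
  unfolding slot_server_def by (rule next_server_min(1)[OF n])

lemma slot_time_le_epoch: "j < n \<Longrightarrow> slot_time n y r \<le> epoch y j (completions n y r j)"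
  unfolding slot_server_def slot_time_def
  using next_server_min(2)[OF n, of j "\<lambda>j. epoch y j (completions n y r j)"] by simp

lemma epoch_mono: "i < n \<Longrightarrow> l \<le> m \<Longrightarrow> epoch y i l \<le> epoch y i m"
  unfolding epoch_def using y_nonneg by (intro sum_mono2) auto

lemma epoch_nonneg: "i < n \<Longrightarrow> 0 \<le> epoch y i l"
  unfolding epoch_def using y_nonneg by (intro sum_nonneg) auto

lemma slot_time_mono: assumes "q \<le> r" shows "slot_time n y q \<le> slot_time n y r"
proof -
  have "slot_time n y q \<le> epoch y (slot_server n y r) (completions n y q (slot_server n y r))"
    by (rule slot_time_le_epoch[OF slot_server_less])
  also have "\<dots> \<le> slot_time n y r"
    unfolding slot_time_def by (rule epoch_mono[OF slot_server_less completions_mono[OF assms]])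
  finally show ?thesis .
qed

lemma slot_time_nonneg: "0 \<le> slot_time n y r"
  unfolding slot_time_def by (rule epoch_nonneg[OF slot_server_less])

lemma sum_completions: "(\<Sum>i<n. completions n y r i) = r"
proof (induction r)
  case (Suc r)
  let ?i = "slot_server n y r"
  have "(\<Sum>i<n. completions n y (Suc r) i) = (\<Sum>i<n. completions n y r i + (if i = ?i then 1 else 0))"
    by (intro sum.cong) (auto simp: completions_Suc)
  also have "\<dots> = Suc r" using Suc slot_server_less[of r] by (simp add: sum.distrib)
  finally show ?case .
qed simp

lemma slot_of_completed_epoch:
  "l < completions n y r i \<Longrightarrow> \<exists>q<r. slot_server n y q = i \<and> epoch y i l = slot_time n y q"
proof (induction r)
  case (Suc r)
  show ?case
  proof (cases "l < completions n y r i")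
    case True
    then show ?thesis using Suc.IH less_SucI by blast
  next
    case False
    with Suc.prems have "slot_server n y r = i" "l = completions n y r i"
      by (auto simp: completions_Suc split: if_splits)
    then show ?thesis by (auto simp: slot_time_def intro!: exI[of _ r])
  qed
qed simp

lemma completed_epoch_le: "l < completions n y (Suc r) i \<Longrightarrow> epoch y i l \<le> slot_time n y r"
  using slot_of_completed_epoch[of l "Suc r" i] slot_time_mono by fastforce

lemma epoch_less_completions:
  assumes "i < n" "epoch y i l < slot_time n y r" shows "l < completions n y r i"
proof (rule ccontr)
  assume "\<not> ?thesis"
  then have "epoch y i (completions n y r i) \<le> epoch y i l" by (intro epoch_mono[OF assms(1)]) simp
  with assms slot_time_le_epoch[of i r] show False by simp
qed

text \<open>There are \<open>r\<close> completions before slot \<open>r\<close>, whereas only finitely many epochs of the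
  \<open>n\<close> servers lie before a given time.\<close>

lemma slot_time_unbounded:
  assumes "\<And>i. i < n \<Longrightarrow> \<exists>m. t < epoch y i m"
  shows "\<exists>r. t < slot_time n y r"
proof (rule ccontr)
  assume "\<not> ?thesis"
  then have le: "slot_time n y r \<le> t" for r by (simp add: not_less)
  from assms obtain m where m: "\<And>i. i < n \<Longrightarrow> t < epoch y i (m i)" by metis
  have "completions n y r i \<le> m i" if i: "i < n" for r i
  proof (rule ccontr)
    assume "\<not> ?thesis"
    then have "m i < completions n y r i" by simp
    then obtain q where "epoch y i (m i) = slot_time n y q" using slot_of_completed_epoch by blast
    with m[OF i] le[of q] show False by simp
  qed
  then have "(\<Sum>i<n. completions n y r i) \<le> (\<Sum>i<n. m i)" for r by (intro sum_mono) auto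
  then have "r \<le> (\<Sum>i<n. m i)" for r by (simp add: sum_completions)
  from this[of "Suc (\<Sum>i<n. m i)"] show False by simp
qed

end

locale merged_paths = service_paths +
  fixes a :: "nat \<Rightarrow> real"
  assumes epoch_unbounded: "\<And>i t. i < n \<Longrightarrow> \<exists>m. t < epoch y i m"
    and a_mono: "j \<le> k \<Longrightarrow> a j \<le> a k"
    and a_nonneg: "0 \<le> a k"
    and a_unbounded: "\<exists>k. t < a k"
begin

lemma started_unbounded: "\<exists>r. k \<le> started n a y r"
proof (induction k)
  case (Suc k)
  then obtain r where r: "k \<le> started n a y r" by auto
  obtain q where q: "a k < slot_time n y q" using slot_time_unbounded epoch_unbounded by blast
  let ?m = "max q r"
  have "k \<le> started n a y ?m" "a k < slot_time n y ?m"
    using r q started_mono[of r ?m n a y] slot_time_mono[of q ?m] by auto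
  then have "Suc k \<le> started n a y (Suc ?m)" 
    by (cases "started n a y ?m = k") auto
  then show ?case by blast
qed simp

lemma starts_at_job_slot: "starts_at n a y k (job_slot n a y k)"
proof -
  obtain r where "Suc k \<le> started n a y r" using started_unbounded by blast
  then obtain q where "starts_at n a y k q" using starts_at_exists_less[of k] by (metis Suc_le_eq)
  with job_slot_eq[OF this] show ?thesis by simp
qed

lemma job_slot_less: "job_slot n a y k < job_slot n a y (Suc k)"
  using started_less_iff[OF starts_at_job_slot, of k "job_slot n a y (Suc k)"] starts_at_job_slot[of "Suc k"]
  by (auto simp: starts_at_def)

section \<open>Jobs start no later than in their slots\<close>

text \<open>By induction on \<open>k\<close>, the last commitment of each server of the queue before job \<open>k\<close> is matched
  with a service \<open>(p, l)\<close> of the unpausing servers that ends no earlier, different commitments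
  with different services, and all of them begun by the slot of job \<open>k\<close>. If the queue had no
  free server at the time of that slot, all \<open>n\<close> matched services would end later. But each
  unpausing server has only one unfinished service at that time, and the server of the slot
  has none.\<close>

lemma start_time_le_slot_time:
  fixes v s
  defines "v \<equiv> \<lambda>i. y i 0" and "s \<equiv> job_service n a y"
  shows "start_time n v a s k \<le> slot_time n y (job_slot n a y k)"
proof -
  let ?\<sigma> = "\<lambda>k. slot_time n y (job_slot n a y k)"
  let ?p = "\<lambda>k. slot_server n y (job_slot n a y k)"
  let ?c = "\<lambda>k. completions n y (job_slot n a y k)"
  let ?w = "free_time n v a s"
  define matched where "matched k \<tau> \<longleftrightarrow> inj_on \<tau> {..<n} \<and> (\<forall>i<n. fst (\<tau> i) < n \<and>
      ?w k i \<le> epoch y (fst (\<tau> i)) (snd (\<tau> i)) \<and> snd (\<tau> i) \<le> ?c k (fst (\<tau> i)))"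
    for k and \<tau> :: "nat \<Rightarrow> nat \<times> nat"
  have free: "start_time n v a s k \<le> ?\<sigma> k" if "matched k \<tau>" for k \<tau>
  proof -
    have "\<exists>i<n. ?w k i \<le> ?\<sigma> k"
    proof (rule ccontr)
      assume "\<not> ?thesis"
      then have late: "?\<sigma> k < ?w k i" if "i < n" for i using that by force
      have current: "snd (\<tau> i) = ?c k (fst (\<tau> i))" if i: "i < n" for i
      proof (rule ccontr)
        assume "snd (\<tau> i) \<noteq> ?c k (fst (\<tau> i))"
        then have "snd (\<tau> i) < ?c k (fst (\<tau> i))" using \<open>matched k \<tau>\<close> i unfolding matched_def by force
        then have "epoch y (fst (\<tau> i)) (snd (\<tau> i)) \<le> ?\<sigma> k"
          using completions_mono[of "job_slot n a y k" "Suc (job_slot n a y k)" n y "fst (\<tau> i)"]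
          by (intro completed_epoch_le) simp
        with late[OF i] \<open>matched k \<tau>\<close> i show False unfolding matched_def by force
      qed
      have "fst (\<tau> i) \<noteq> ?p k" if i: "i < n" for i
      proof
        assume "fst (\<tau> i) = ?p k"
        then have "epoch y (fst (\<tau> i)) (snd (\<tau> i)) = ?\<sigma> k"
          using current[OF i] by (simp add: slot_time_def)
        with late[OF i] \<open>matched k \<tau>\<close> i show False unfolding matched_def by force
      qed
      then have sub: "(\<lambda>i. fst (\<tau> i)) ` {..<n} \<subseteq> {..<n} - {?p k}"
        using \<open>matched k \<tau>\<close> unfolding matched_def by auto
      have "inj_on (\<lambda>i. fst (\<tau> i)) {..<n}"
        using \<open>matched k \<tau>\<close> current unfolding matched_def inj_on_def by (metis lessThan_iff prod.expand)
      from card_inj_on_le[OF this sub] show False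
        using slot_server_less[of "job_slot n a y k"] by simp
    qed
    then have "?w k (next_server n (?w k)) \<le> ?\<sigma> k"
      using next_server_min(2)[OF n, of _ "?w k"] by force
    then show ?thesis
      using starts_at_job_slot[of k] by (simp add: start_time_def Let_def starts_at_def)
  qed
  have "\<exists>\<tau>. matched k \<tau>"
  proof (induction k)
    case 0
    show ?case by (rule exI[of _ "\<lambda>i. (i, 0)"]) (auto simp: matched_def inj_on_def epoch_def v_def)
  next
    case (Suc k)
    then obtain \<tau> where matched: "matched k \<tau>" by auto
    let ?i = "next_server n (?w k)"
    \<comment> \<open>The new commitment is matched with the service that job \<open>k\<close> gets at its slot.\<close>
    let ?\<tau> = "\<tau>(?i := (?p k, Suc (?c k (?p k))))"
    have slots: "Suc (job_slot n a y k) \<le> job_slot n a y (Suc k)" using job_slot_less[of k] by simp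
    have compl: "completions n y (Suc (job_slot n a y k)) i \<le> ?c (Suc k) i" for i
      by (rule completions_mono[OF slots])
    have "?c k i \<le> ?c (Suc k) i" for i
      by (rule completions_mono) (use slots in simp)
    then have old: "snd (\<tau> i) \<le> ?c (Suc k) (fst (\<tau> i))" if "i < n" for i
      using matched that unfolding matched_def by (meson order_trans)
    have new: "Suc (?c k (?p k)) \<le> ?c (Suc k) (?p k)"
      using compl[of "?p k"] by (simp add: completions_Suc)
    have "?w (Suc k) ?i = start_time n v a s k + s k" by (rule free_time_Suc_serving)
    also have "\<dots> \<le> ?\<sigma> k + s k" using free[OF matched] by simp
    also have "\<dots> = epoch y (?p k) (Suc (?c k (?p k)))"
      by (simp add: s_def job_service_def slot_service_def slot_time_def epoch_def)
    finally have newfree: "?w (Suc k) ?i \<le> epoch y (?p k) (Suc (?c k (?p k)))" .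
    have oldfree: "?w (Suc k) i = ?w k i" if "i \<noteq> ?i" for i using that by (simp add: Let_def)
    have "(?p k, Suc (?c k (?p k))) \<noteq> \<tau> i" if "i < n" for i
      using matched that unfolding matched_def by (metis Suc_n_not_le_n fst_conv snd_conv)
    then have "inj_on ?\<tau> {..<n}" using matched unfolding matched_def inj_on_def by auto
    moreover have "\<forall>i<n. fst (?\<tau> i) < n \<and> ?w (Suc k) i \<le> epoch y (fst (?\<tau> i)) (snd (?\<tau> i)) \<and>
        snd (?\<tau> i) \<le> ?c (Suc k) (fst (?\<tau> i))"
      using old new newfree oldfree matched slot_server_less[of "job_slot n a y k"]
      unfolding matched_def by (auto simp del: free_time.simps)
    ultimately show ?case unfolding matched_def by blast
  qed
  with free show ?thesis by blast
qed

section \<open>The excess over a window before the present\<close>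

lemma arrivals_initial_segment: "\<exists>m. {k. a k \<le> t} = {..<m}"
proof -
  let ?m = "LEAST k. t < a k"
  have "t < a ?m" using LeastI_ex[OF a_unbounded] .
  moreover have "k < ?m \<Longrightarrow> a k \<le> t" for k using not_less_Least by force
  ultimately have "{k. a k \<le> t} = {..<?m}" using a_mono
    by (auto) (meson dual_order.strict_trans1 le_less_linear linorder_not_less order_trans)
  then show ?thesis by blast
qed

lemma slots_by_time: "\<exists>r. t < slot_time n y r \<and> (\<forall>q<r. slot_time n y q \<le> t)"
proof -
  let ?r = "LEAST r. t < slot_time n y r"
  have "t < slot_time n y ?r" by (rule LeastI_ex[OF slot_time_unbounded[OF epoch_unbounded]])
  moreover have "q < ?r \<Longrightarrow> slot_time n y q \<le> t" for q using not_less_Least by force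
  ultimately show ?thesis by blast
qed

text \<open>The length of the window is \<open>t\<close> or rational, so that countably many windows suffice. It is
  \<open>t\<close> if no slot up to time \<open>t\<close> starts an artificial service; otherwise the window begins between
  the last artificial service and the first arrival after it.\<close>

theorem excess_bound:
  fixes v s
  defines "v \<equiv> \<lambda>i. y i 0" and "s \<equiv> job_service n a y"
  assumes x: "0 < x" and exceeds: "x < real (number_in_system n v a s t) - real n"
  shows "\<exists>q. (q = t \<or> q \<in> \<rat>) \<and> 0 \<le> q \<and> q \<le> t \<and>
     x < real (card {k. t - q \<le> a k \<and> a k \<le> t})
       - (\<Sum>i<n. real (card {m. t - q \<le> epoch y i m \<and> epoch y i m \<le> t}))"
proof -
  let ?C = "completions n y" and ?\<tau> = "slot_time n y" and ?K = "started n a y"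
  obtain m where m: "{k. a k \<le> t} = {..<m}" using arrivals_initial_segment by blast
  then have m_iff: "a k \<le> t \<longleftrightarrow> k < m" for k by auto
  obtain r where r: "t < ?\<tau> r" and before_r: "\<And>q. q < r \<Longrightarrow> ?\<tau> q \<le> t"
    using slots_by_time by blast
  have s_nonneg: "0 \<le> s k" for k
    unfolding s_def job_service_def slot_service_def by (rule y_nonneg[OF slot_server_less])
  have "{k. a k \<le> t \<and> t < start_time n v a s k} \<subseteq> {?K r..<m}"
  proof
    fix k assume k: "k \<in> {k. a k \<le> t \<and> t < start_time n v a s k}"
    then have "t < ?\<tau> (job_slot n a y k)"
      using start_time_le_slot_time[of k] unfolding v_def s_def by simp
    then have "\<not> job_slot n a y k < r" using before_r by force
    then show "k \<in> {?K r..<m}"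
      using k m_iff started_less_iff[OF starts_at_job_slot, of k r] by auto
  qed
  then have "number_waiting n v a s t \<le> card {?K r..<m}"
    unfolding number_waiting_def by (intro card_mono) auto
  then have x_less: "x < real (m - ?K r)"
    using exceeds number_in_service_le[OF n, of s v a t, OF s_nonneg]
    unfolding number_in_system_def by simp
  with x have K_less: "?K r < m" by (cases "?K r < m") auto
  have completed: "l < ?C r i" if "i < n" "epoch y i l \<le> t" for i l
    using epoch_less_completions[of i l r] r that by simp
  \<comment> \<open>A window that begins after the slots before \<open>p\<close> contains at most the slots \<open>p, \<dots>, r - 1\<close>.\<close>
  have services: "(\<Sum>i<n. real (card {l. u \<le> epoch y i l \<and> epoch y i l \<le> t})) \<le> real (r - p)"
    if u: "\<And>q. q < p \<Longrightarrow> ?\<tau> q < u" and p: "p \<le> r" for u p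
  proof -
    have sub: "{l. u \<le> epoch y i l \<and> epoch y i l \<le> t} \<subseteq> {?C p i..<?C r i}" if i: "i < n" for i
    proof
      fix l assume l: "l \<in> {l. u \<le> epoch y i l \<and> epoch y i l \<le> t}"
      have "\<not> l < ?C p i"
      proof
        assume "l < ?C p i"
        from slot_of_completed_epoch[OF this] u l show False by force
      qed
      with completed[OF i] l show "l \<in> {?C p i..<?C r i}" by auto
    qed
    have "(\<Sum>i<n. real (card {l. u \<le> epoch y i l \<and> epoch y i l \<le> t}))
        \<le> (\<Sum>i<n. real (?C r i - ?C p i))"
    proof (rule sum_mono)
      fix i assume "i \<in> {..<n}"
      then show "real (card {l. u \<le> epoch y i l \<and> epoch y i l \<le> t}) \<le> real (?C r i - ?C p i)"
        using card_mono[OF _ sub[of i]] by simp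
    qed
    also have "\<dots> = (\<Sum>i<n. real (?C r i)) - (\<Sum>i<n. real (?C p i))"
      using completions_mono[OF p, of n y] by (simp add: of_nat_diff sum_subtractf)
    also have "\<dots> = real r - real p"
      unfolding of_nat_sum[symmetric] sum_completions by simp
    finally show ?thesis using p by (simp add: of_nat_diff)
  qed
  \<comment> \<open>While no service is artificial, each slot starts a job.\<close>
  have busy: "(\<And>q. p \<le> q \<Longrightarrow> q < r' \<Longrightarrow> a (?K q) \<le> ?\<tau> q) \<Longrightarrow> p \<le> r' \<Longrightarrow> ?K r' = ?K p + (r' - p)" for p r'
  proof (induction r')
    case (Suc r')
    then show ?case using Suc.prems(1)[of r'] by (cases "p = Suc r'") auto
  qed simp
  show ?thesis
  proof (cases "\<forall>q<r. a (?K q) \<le> ?\<tau> q")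
    case True
    then have K: "?K r = r" using busy[of 0 r] by simp
    have "{k. t - t \<le> a k \<and> a k \<le> t} = {..<m}" using m a_nonneg by auto
    then have "x < real (card {k. t - t \<le> a k \<and> a k \<le> t})
       - (\<Sum>i<n. real (card {m. t - t \<le> epoch y i m \<and> epoch y i m \<le> t}))"
      using x_less K K_less services[of 0 0] by (simp add: of_nat_diff)
    moreover have "0 \<le> t" using K_less m_iff a_nonneg[of 0] by (metis order_trans zero_less_iff_neq_zero not_less0)
    ultimately show ?thesis by auto
  next
    case False
    let ?I = "{q. q < r \<and> ?\<tau> q < a (?K q)}"
    \<comment> \<open>The slot of the last artificial service.\<close>
    define p where "p = Max ?I"
    have "p \<in> ?I" unfolding p_def using False by (intro Max_in) (auto simp: not_le)
    then have p: "p < r" "?\<tau> p < a (?K p)" by auto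
    have "q \<le> p" if "q < r" "?\<tau> q < a (?K q)" for q
      unfolding p_def using that by (intro Max_ge) auto
    then have "a (?K q) \<le> ?\<tau> q" if "Suc p \<le> q" "q < r" for q using that by (force simp: not_le)
    from busy[OF this] p have Kr: "?K r = ?K (Suc p) + (r - Suc p)" by simp
    have K_Suc: "?K (Suc p) = ?K p" using p(2) by simp
    have arrived: "a (?K p) \<le> t" using m_iff K_less Kr K_Suc by simp
    obtain q where q: "q \<in> \<rat>" "t - a (?K p) < q" "q < t - ?\<tau> p"
      using Rats_dense_in_real[of "t - a (?K p)" "t - ?\<tau> p"] p by auto
    have "{?K p..<m} \<subseteq> {k. t - q \<le> a k \<and> a k \<le> t}"
    proof
      fix k assume "k \<in> {?K p..<m}"
      then show "k \<in> {k. t - q \<le> a k \<and> a k \<le> t}" using a_mono[of "?K p" k] m_iff q by auto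
    qed
    moreover have "finite {k. t - q \<le> a k \<and> a k \<le> t}"
      by (rule finite_subset[of _ "{..<m}"]) (use m_iff in auto)
    ultimately have "card {?K p..<m} \<le> card {k. t - q \<le> a k \<and> a k \<le> t}"
      by (intro card_mono)
    then have "m - ?K p \<le> card {k. t - q \<le> a k \<and> a k \<le> t}" by simp
    moreover have "(\<Sum>i<n. real (card {l. t - q \<le> epoch y i l \<and> epoch y i l \<le> t})) \<le> real (r - Suc p)"
    proof (rule services)
      fix p' assume "p' < Suc p"
      then show "?\<tau> p' < t - q" using slot_time_mono[of p' p] q by simp
    qed (use p in simp)
    ultimately have "x < real (card {k. t - q \<le> a k \<and> a k \<le> t})
       - (\<Sum>i<n. real (card {m. t - q \<le> epoch y i m \<and> epoch y i m \<le> t}))"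
      using x_less K_less Kr K_Suc by linarith
    moreover have "0 \<le> q" "q \<le> t" using q arrived slot_time_nonneg[of p] by auto
    ultimately show ?thesis using q by blast
  qed
qed

end

section \<open>Measurability of the slots\<close>

lemma measurable_select:
  fixes g :: "'c \<Rightarrow> nat"
  assumes g: "g \<in> measurable N (count_space UNIV)" and less: "\<And>\<omega>. g \<omega> < n"
    and f: "\<And>i. i < n \<Longrightarrow> (\<lambda>\<omega>. f i \<omega>) \<in> measurable N L"
  shows "(\<lambda>\<omega>. f (g \<omega>) \<omega>) \<in> measurable N L"
proof (rule measurable_compose_countable'[where I="{..<n}", OF f])
  show "g \<in> measurable N (count_space {..<n})"
    using measurable_sets[OF g] less by (auto simp: measurable_count_space_eq2_countable)
qed auto

lemma measurable_next_server:
  assumes [measurable]: "\<And>i. i < n \<Longrightarrow> (\<lambda>\<omega>. w \<omega> i) \<in> borel_measurable N"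
  shows "(\<lambda>\<omega>. next_server n (w \<omega>)) \<in> measurable N (count_space UNIV)"
  unfolding next_server_def
proof (rule measurable_Least)
  fix i
  show "Measurable.pred N (\<lambda>\<omega>. i < n \<and> (\<forall>j<n. w \<omega> i \<le> w \<omega> j))"
  proof (cases "i < n")
    case True
    have "Measurable.pred N (\<lambda>\<omega>. \<forall>j\<in>{..<n}. w \<omega> i \<le> w \<omega> j)"
      using True by (intro pred_intros_finite) auto
    then show ?thesis using True by simp
  qed simp
qed

locale measurable_paths =
  fixes N :: "'c measure" and n :: nat and a :: "'c \<Rightarrow> nat \<Rightarrow> real" and y :: "'c \<Rightarrow> nat \<Rightarrow> nat \<Rightarrow> real"
  assumes n: "n \<ge> 1"
    and a[measurable]: "\<And>k. (\<lambda>\<omega>. a \<omega> k) \<in> borel_measurable N"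
    and y: "\<And>i l. i < n \<Longrightarrow> (\<lambda>\<omega>. y \<omega> i l) \<in> borel_measurable N"
begin

lemma measurable_epoch:
  assumes "i < n" "g \<in> measurable N (count_space UNIV)"
  shows "(\<lambda>\<omega>. epoch (y \<omega>) i (g \<omega>)) \<in> borel_measurable N"
proof (rule measurable_compose_countable[OF _ assms(2)])
  show "(\<lambda>\<omega>. epoch (y \<omega>) i m) \<in> borel_measurable N" for m
    unfolding epoch_def by (intro borel_measurable_sum y assms(1))
qed

lemma measurable_completions:
  "(\<lambda>\<omega>. completions n (y \<omega>) r i) \<in> measurable N (count_space UNIV)"
  and measurable_slot_server:
  "(\<lambda>\<omega>. slot_server n (y \<omega>) r) \<in> measurable N (count_space UNIV)"
proof -
  have server: "(\<lambda>\<omega>. slot_server n (y \<omega>) r) \<in> measurable N (count_space UNIV)"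
    if "\<And>i. (\<lambda>\<omega>. completions n (y \<omega>) r i) \<in> measurable N (count_space UNIV)" for r
    unfolding slot_server_def
    by (rule measurable_next_server) (rule measurable_epoch[OF _ that])
  have *: "(\<lambda>\<omega>. completions n (y \<omega>) r i) \<in> measurable N (count_space UNIV)" for r i
  proof (induction r arbitrary: i)
    case (Suc r)
    note [measurable] = Suc server[OF Suc]
    show ?case
      unfolding completions_Suc fun_upd_def
      by (rule measurable_compose_countable[where g="\<lambda>\<omega>. slot_server n (y \<omega>) r"]) measurable
  qed simp
  show "(\<lambda>\<omega>. completions n (y \<omega>) r i) \<in> measurable N (count_space UNIV)" by (rule *)
  show "(\<lambda>\<omega>. slot_server n (y \<omega>) r) \<in> measurable N (count_space UNIV)" by (rule server[OF *])
qed

lemma slot_server_less: "slot_server n (y \<omega>) r < n"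
  unfolding slot_server_def by (rule next_server_min(1)[OF n])

lemma measurable_slot_time[measurable]: "(\<lambda>\<omega>. slot_time n (y \<omega>) r) \<in> borel_measurable N"
  unfolding slot_time_def
  by (rule measurable_select[OF measurable_slot_server slot_server_less])
    (rule measurable_epoch[OF _ measurable_completions])

lemma measurable_slot_service[measurable]: "(\<lambda>\<omega>. slot_service n (y \<omega>) r) \<in> borel_measurable N"
  unfolding slot_service_def
  by (rule measurable_select[OF measurable_slot_server slot_server_less])
    (rule measurable_compose_countable[OF y measurable_completions])

lemma measurable_started[measurable]:
  "(\<lambda>\<omega>. started n (a \<omega>) (y \<omega>) r) \<in> measurable N (count_space UNIV)"
proof (induction r)
  case (Suc r)
  note [measurable] = Suc measurable_compose_countable[OF a Suc]
  show ?case by simp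
qed simp

lemma measurable_starts_at[measurable]: "Measurable.pred N (\<lambda>\<omega>. starts_at n (a \<omega>) (y \<omega>) k r)"
  unfolding starts_at_def by measurable

lemma measurable_job_slot[measurable]:
  "(\<lambda>\<omega>. job_slot n (a \<omega>) (y \<omega>) k) \<in> measurable N (count_space UNIV)"
  unfolding job_slot_def by measurable

lemma measurable_job_service[measurable]:
  "(\<lambda>\<omega>. job_service n (a \<omega>) (y \<omega>) k) \<in> borel_measurable N"
  unfolding job_service_def
  by (rule measurable_compose_countable[OF measurable_slot_service measurable_job_slot])

end

section \<open>The processing times of the jobs are fresh\<close>

text \<open>Slots are found by inspecting the services in order. Up to slot \<open>r\<close>, no service of server \<open>i\<close>
  beyond number \<open>m = completions n y r i\<close> has been inspected, so changing the service that
  begins at the slot affects neither the slot nor the earlier jobs.\<close>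

lemma starts_at_ignores_service:
  assumes n: "n \<ge> 1" and start: "starts_at n a y K r"
    and server: "slot_server n y r = i" and count: "completions n y r i = m"
    and agree: "\<And>j l. j < n \<Longrightarrow> (j, l) \<noteq> (i, Suc m) \<Longrightarrow> y' j l = y j l"
  shows "starts_at n a y' K r" and "slot_server n y' r = i" and "completions n y' r i = m"
    and "k < K \<Longrightarrow> job_service n a y' k = job_service n a y k"
proof -
  have less: "slot_server n y q < n" for q
    unfolding slot_server_def by (rule next_server_min(1)[OF n])
  have unseen: "completions n y q i \<le> m" if "q \<le> r" for q
    using completions_mono[OF that, of n y i] count by simp
  have epochs: "epoch y' j (completions n y q j) = epoch y j (completions n y q j)" if "j < n" "q \<le> r" for q j
    unfolding epoch_def using unseen[OF that(2)] that(1) by (intro sum.cong agree) auto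
  have same_server: "slot_server n y' q = slot_server n y q"
    if "completions n y' q = completions n y q" "q \<le> r" for q
    unfolding slot_server_def that(1) by (rule next_server_cong) (rule epochs[OF _ that(2)])
  have compl: "completions n y' q = completions n y q" if "q \<le> r" for q
    using that
  proof (induction q)
    case (Suc q)
    then show ?case using same_server[of q] by (simp add: completions_Suc)
  qed simp
  have time: "slot_time n y' q = slot_time n y q" if "q \<le> r" for q
    unfolding slot_time_def same_server[OF compl[OF that] that] compl[OF that]
    by (rule epochs[OF less that])
  have starts: "started n a y' q = started n a y q" if "q \<le> r" for q
    using that by (induction q) (auto simp: time)
  have at: "starts_at n a y' k q \<longleftrightarrow> starts_at n a y k q" if "q \<le> r" for k q
    unfolding starts_at_def starts[OF that] time[OF that] ..
  show "starts_at n a y' K r" using start at by simp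
  show "slot_server n y' r = i" using same_server[OF compl] server by simp
  show "completions n y' r i = m" using compl count by simp
  assume "k < K"
  then obtain q where q: "q < r" "starts_at n a y k q"
    using start starts_at_exists_less[of k n a y r] by (auto simp: starts_at_def)
  then have slot: "job_slot n a y' k = q" "job_slot n a y k = q"
    using at[of q k] by (auto intro: job_slot_eq)
  let ?p = "slot_server n y q"
  have "Suc (completions n y q ?p) \<le> m" if "?p = i"
    using unseen[of "Suc q"] q that by (simp add: completions_Suc)
  then have "slot_service n y' q = slot_service n y q"
    unfolding slot_service_def using q compl[of q] same_server[OF compl, of q]
    by (auto intro!: agree less)
  then show "job_service n a y' k = job_service n a y k" unfolding job_service_def slot .
qed

context prob_space
begin

lemma indep_vars_reindex:
  assumes "indep_vars L Z (f ` I)" and inj: "inj_on f I"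
  shows "indep_vars (\<lambda>i. L (f i)) (\<lambda>i. Z (f i)) I"
proof -
  have "indep_vars (\<lambda>i. PiM {f i} L) (\<lambda>i \<omega>. restrict (\<lambda>j. Z j \<omega>) {f i}) I"
    by (rule indep_vars_restrict[OF assms(1)])
      (use inj in \<open>auto simp: disjoint_family_on_def inj_on_def\<close>)
  from indep_vars_compose2[OF this, of "\<lambda>i w. w (f i)" "\<lambda>i. L (f i)"]
  show ?thesis by simp
qed

text \<open>An event that no change of coordinate \<open>c\<close> affects is determined by the family without \<open>c\<close>.\<close>

lemma prob_unused_coordinate:
  fixes Z :: "'i \<Rightarrow> 'a \<Rightarrow> real"
  assumes indep: "indep_vars (\<lambda>_. borel) Z J" and c: "c \<in> J"
    and \<Phi>: "Measurable.pred (PiM J (\<lambda>_. borel)) \<Phi>"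
    and unused: "\<And>z z'. (\<And>j. j \<in> J \<Longrightarrow> j \<noteq> c \<Longrightarrow> z' j = z j) \<Longrightarrow> \<Phi> z \<Longrightarrow> \<Phi> z'"
    and C: "C \<in> sets borel"
  shows "prob {\<omega>\<in>space M. \<Phi> (\<lambda>j. Z j \<omega>) \<and> Z c \<omega> \<in> C} =
    prob {\<omega>\<in>space M. \<Phi> (\<lambda>j. Z j \<omega>)} * prob {\<omega>\<in>space M. Z c \<omega> \<in> C}"
proof -
  let ?A = "J - {c}"
  let ?rest = "\<lambda>\<omega>. restrict (\<lambda>j. Z j \<omega>) ?A"
  have ind: "indep_var (PiM ?A (\<lambda>_. borel)) ?rest
      (PiM {c} (\<lambda>_. borel)) (\<lambda>\<omega>. restrict (\<lambda>j. Z j \<omega>) {c})"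
    by (rule indep_var_restrict[OF indep]) (use c in auto)
  have iff: "\<Phi> ((?rest \<omega>)(c := 0)) \<longleftrightarrow> \<Phi> (\<lambda>j. Z j \<omega>)" for \<omega>
    using unused[of "(?rest \<omega>)(c := 0)" "\<lambda>j. Z j \<omega>"] unused[of "\<lambda>j. Z j \<omega>" "(?rest \<omega>)(c := 0)"] by auto
  let ?X = "{w \<in> space (PiM ?A (\<lambda>_. borel)). \<Phi> (w(c := 0))}"
  have "(\<lambda>w. w(c := 0)) \<in> measurable (PiM ?A (\<lambda>_. borel)) (PiM J (\<lambda>_. borel))"
    using c by (intro measurable_fun_upd[where J="?A"]) auto
  then have X: "?X \<in> sets (PiM ?A (\<lambda>_. borel))"
    using measurable_compose[OF _ \<Phi>] by (simp add: pred_def)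
  let ?C = "{w \<in> space (PiM {c} (\<lambda>_. borel)). w c \<in> C}"
  have C': "?C \<in> sets (PiM {c} (\<lambda>_. borel))" using C by measurable
  have rest: "?rest \<omega> \<in> space (PiM ?A (\<lambda>_. borel))" for \<omega> by (simp add: space_PiM)
  have one: "restrict (\<lambda>j. Z j \<omega>) {c} \<in> space (PiM {c} (\<lambda>_. borel))" for \<omega> by (simp add: space_PiM)
  from indep_varD[OF ind X C'] show ?thesis
    using iff rest one by (simp add: vimage_def Int_def conj_commute)
qed

end


text \<open>The law of the processing times obtained from the slots. Here \<open>Y i 0\<close> is the initial service
  of server \<open>i\<close>, and the family \<open>W\<close> consists of the primitives of the queue that is built from
  the renewal processes.\<close>

locale renewal_services = prob_space M for M :: "'b measure" +
  fixes n :: nat and X :: "nat \<Rightarrow> 'b \<Rightarrow> real" and Y :: "nat \<Rightarrow> nat \<Rightarrow> 'b \<Rightarrow> real" and D :: "real measure"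
  assumes n: "n \<ge> 1"
    and indep: "indep_vars (\<lambda>_. borel) (case_sum X (\<lambda>(i, k). Y i k)) (UNIV <+> ({..<n} \<times> UNIV))"
    and law: "\<And>i k. i < n \<Longrightarrow> distr M borel (Y i (Suc k)) = D"
    and all_start: "AE \<omega> in M. \<forall>k. \<exists>r. starts_at n (\<lambda>k. event_time X k \<omega>) (\<lambda>i l. Y i l \<omega>) k r"
begin

abbreviation "arrival \<omega> k \<equiv> event_time X k \<omega>"
abbreviation "service \<omega> i l \<equiv> Y i l \<omega>"
abbreviation "U k \<omega> \<equiv> job_service n (arrival \<omega>) (service \<omega>) k"
abbreviation "W \<equiv> case_sum X (case_sum (\<lambda>i. Y i 0) U)"
abbreviation "initials \<equiv> range Inl \<union> (Inr \<circ> Inl) ` {..<n} :: (nat + (nat + nat)) set"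

lemma Y_measurable[measurable (raw)]: "i < n \<Longrightarrow> Y i k \<in> borel_measurable M"
  and X_measurable[measurable]: "X k \<in> borel_measurable M"
proof -
  have "random_variable borel (case_sum X (\<lambda>(i, k). Y i k) j)" if "j \<in> UNIV <+> ({..<n} \<times> UNIV)" for j
    using indep that unfolding indep_vars_def by blast
  from this[of "Inr (i, k)"] this[of "Inl k"]
  show "i < n \<Longrightarrow> Y i k \<in> borel_measurable M" "X k \<in> borel_measurable M" by auto
qed

sublocale measurable_paths M n "arrival" "service"
  by standard (use n in \<open>auto simp: event_time_def\<close>)

lemma W_measurable: "j \<in> UNIV <+> ({..<n} <+> UNIV) \<Longrightarrow> W j \<in> borel_measurable M"
  by (auto split: sum.splits)

lemma D_prob: "prob_space D"
  using prob_space_distr[OF Y_measurable[of 0 "Suc 0"]] law[of 0] n by simp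

lemma indep_initials: "indep_vars (\<lambda>_. borel) W initials"
proof -
  \<comment> \<open>The last case does not occur among the initials; \<open>(n, 0)\<close> is an unused index.\<close>
  let ?e = "\<lambda>j. case j of Inl k \<Rightarrow> Inl k | Inr (Inl i) \<Rightarrow> Inr (i, 0) | Inr (Inr i) \<Rightarrow> Inr (n, 0)"
  have "indep_vars (\<lambda>_. borel) (case_sum X (\<lambda>(i, k). Y i k)) (?e ` initials)"
    by (rule indep_vars_subset[OF indep]) auto
  then have "indep_vars (\<lambda>_. borel) (\<lambda>j. case_sum X (\<lambda>(i, k). Y i k) (?e j)) initials"
    by (rule indep_vars_reindex) (auto simp: inj_on_def)
  then show ?thesis by (rule indep_vars_cong[THEN iffD1, rotated -1]) auto
qed

text \<open>By induction on the number of jobs: split according to the slot \<open>r\<close> of the next job, its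
  server \<open>i\<close> and the number \<open>m\<close> of services completed there. On each part, the event about the
  earlier jobs does not involve the service time \<open>Y i (Suc m)\<close> that the next job gets.\<close>

lemma prob_services:
  assumes "finite J" "J \<subseteq> initials" and B: "\<And>j. B j \<in> sets borel"
    and C: "\<And>k. C k \<in> sets borel"
  shows "prob {\<omega>\<in>space M. (\<forall>j\<in>J. W j \<omega> \<in> B j) \<and> (\<forall>k<K. U k \<omega> \<in> C k)} =
    prob {\<omega>\<in>space M. \<forall>j\<in>J. W j \<omega> \<in> B j} * (\<Prod>k<K. measure D (C k))"
proof (induction K)
  case (Suc K)
  \<comment> \<open>The primitives as functions of the family \<open>z\<close> of all inter-event times, so that dependence
    on a single coordinate can be expressed.\<close>
  let ?J = "UNIV <+> ({..<n} \<times> UNIV) :: (nat + nat \<times> nat) set"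
  let ?Z = "case_sum X (\<lambda>(i, k). Y i k)"
  let ?a = "\<lambda>z k. \<Sum>j\<le>k. z (Inl j)" and ?y = "\<lambda>z i l. z (Inr (i, l))"
  let ?W0 = "\<lambda>z. case_sum (\<lambda>k. z (Inl k)) (case_sum (\<lambda>i. z (Inr (i, 0))) (\<lambda>k. 0 :: real))"
  define \<Phi> where "\<Phi> = (\<lambda>(r, i, m) z. (\<forall>j\<in>J. ?W0 z j \<in> B j) \<and> (\<forall>k<K. job_service n (?a z) (?y z) k \<in> C k) \<and>
      starts_at n (?a z) (?y z) K r \<and> slot_server n (?y z) r = i \<and> completions n (?y z) r i = m)"
  have J_cases: "(\<exists>k. j = Inl k) \<or> (\<exists>i<n. j = Inr (Inl i))" if "j \<in> J" for j
    using that assms(2) by auto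
  have W_eq: "?W0 (\<lambda>j. ?Z j \<omega>) j = W j \<omega>" if "j \<in> J" for j \<omega>
    using that assms(2) by (auto split: sum.splits)
  define R0 where "R0 = (\<lambda>\<omega>. (\<forall>j\<in>J. W j \<omega> \<in> B j) \<and> (\<forall>k\<in>{..<K}. U k \<omega> \<in> C k))"
  have \<Phi>_eq: "\<Phi> t (\<lambda>j. ?Z j \<omega>) \<longleftrightarrow> (case t of (r, i, m) \<Rightarrow>
      R0 \<omega> \<and> starts_at n (arrival \<omega>) (service \<omega>) K r \<and>
       slot_server n (service \<omega>) r = i \<and> completions n (service \<omega>) r i = m)" for t \<omega>
    by (cases t) (simp add: \<Phi>_def R0_def event_time_def W_eq Ball_def cong: ball_cong conj_cong)
  interpret PZ: measurable_paths "PiM ?J (\<lambda>_. borel)" n ?a ?y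
    by standard (use n in \<open>auto intro!: borel_measurable_sum measurable_component_singleton\<close>)
  have J_fst: "j \<in> J \<Longrightarrow> (\<lambda>z. ?W0 z j) \<in> borel_measurable (PiM ?J (\<lambda>_. borel))" for j
    by (drule J_cases) (auto intro!: measurable_component_singleton)
  have \<Phi>_meas: "Measurable.pred (PiM ?J (\<lambda>_. borel)) (\<Phi> t)" for t
  proof -
    note [measurable] = PZ.measurable_completions PZ.measurable_slot_server B C
    have "Measurable.pred (PiM ?J (\<lambda>_. borel)) (\<lambda>z. \<forall>j\<in>J. ?W0 z j \<in> B j)"
      using assms(1) J_fst B by (intro pred_intros_finite) (auto intro!: pred_sets2)
    moreover have "Measurable.pred (PiM ?J (\<lambda>_. borel)) (\<lambda>z. \<forall>k\<in>{..<K}. job_service n (?a z) (?y z) k \<in> C k)"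
      by (intro pred_intros_finite pred_sets2[OF C PZ.measurable_job_service]) auto
    ultimately show ?thesis unfolding \<Phi>_def by (auto split: prod.splits)
  qed
  have \<Phi>_unused: "\<Phi> (r, i, m) z'" if agree: "\<And>j. j \<in> ?J \<Longrightarrow> j \<noteq> Inr (i, Suc m) \<Longrightarrow> z' j = z j"
    and \<Phi>: "\<Phi> (r, i, m) z" for r i m z z'
  proof -
    have agree_X: "z' (Inl k) = z (Inl k)" for k by (rule agree) auto
    have agree_Y: "z' (Inr (j, l)) = z (Inr (j, l))" if "j < n" "(j, l) \<noteq> (i, Suc m)" for j l
      using that by (intro agree) auto
    have W': "?W0 z' j = ?W0 z j" if "j \<in> J" for j
      using J_cases[OF that] agree_X agree_Y by auto
    have start: "starts_at n (?a z) (?y z) K r" and server: "slot_server n (?y z) r = i"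
      and count: "completions n (?y z) r i = m"
      using \<Phi> unfolding \<Phi>_def by auto
    note same = starts_at_ignores_service[OF n start server count, of "?y z'", OF agree_Y]
    show ?thesis using \<Phi> same W' unfolding \<Phi>_def by (auto simp: agree_X cong: ball_cong)
  qed
  have R0_measurable[measurable]: "Measurable.pred M R0"
  proof -
    have "Measurable.pred M (\<lambda>\<omega>. \<forall>j\<in>J. W j \<omega> \<in> B j)"
      using assms(1,2) by (intro pred_intros_finite pred_sets2[OF B W_measurable]) auto
    moreover have "Measurable.pred M (\<lambda>\<omega>. \<forall>k\<in>{..<K}. U k \<omega> \<in> C k)"
      by (intro pred_intros_finite pred_sets2[OF C measurable_job_service]) auto
    ultimately show ?thesis
      unfolding R0_def by (rule pred_intros_logic(3))
  qed
  have split: "prob {\<omega>\<in>space M. R0 \<omega> \<and> R \<omega>} =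
      (\<integral>\<^sup>+t. prob {\<omega>\<in>space M. \<Phi> t (\<lambda>j. ?Z j \<omega>) \<and> R \<omega>} \<partial>count_space UNIV)"
    if R[measurable]: "Measurable.pred M R" for R
  proof -
    note [measurable] = measurable_completions measurable_slot_server
    have [measurable]: "Measurable.pred M (\<lambda>\<omega>. \<Phi> t (\<lambda>j. ?Z j \<omega>))" for t
    proof (cases t)
      case (fields r i m)
      show ?thesis unfolding \<Phi>_eq fields prod.case by measurable
    qed
    have "prob {\<omega>\<in>space M. R0 \<omega> \<and> R \<omega>} =
        prob {\<omega>\<in>space M. \<exists>t\<in>UNIV. \<Phi> t (\<lambda>j. ?Z j \<omega>) \<and> R \<omega>}"
    proof (rule prob_eq_AE)
      show "AE \<omega> in M. (R0 \<omega> \<and> R \<omega>) \<longleftrightarrow> (\<exists>t\<in>UNIV. \<Phi> t (\<lambda>j. ?Z j \<omega>) \<and> R \<omega>)"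
        using all_start by eventually_elim (auto simp: \<Phi>_eq)
    qed (simp_all only: UNIV_I bex_UNIV, measurable)
    also have "\<dots> = (\<integral>\<^sup>+t. prob {\<omega>\<in>space M. \<Phi> t (\<lambda>j. ?Z j \<omega>) \<and> R \<omega>} \<partial>count_space UNIV)"
    proof (rule prob_EX_countable)
      show "AE \<omega> in M. \<forall>s\<in>UNIV. \<forall>t\<in>UNIV. \<Phi> s (\<lambda>j. ?Z j \<omega>) \<and> R \<omega> \<longrightarrow> \<Phi> t (\<lambda>j. ?Z j \<omega>) \<and> R \<omega> \<longrightarrow> s = t"
        unfolding \<Phi>_eq by (auto dest: starts_at_unique)
    qed measurable
    finally show ?thesis .
  qed
  have step: "prob {\<omega>\<in>space M. \<Phi> t (\<lambda>j. ?Z j \<omega>) \<and> U K \<omega> \<in> C K} =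
      prob {\<omega>\<in>space M. \<Phi> t (\<lambda>j. ?Z j \<omega>)} * measure D (C K)" for t
  proof -
    obtain r i m where t: "t = (r, i, m)" by (cases t)
    show ?thesis
    proof (cases "i < n")
      case False
      then have "\<not> \<Phi> t (\<lambda>j. ?Z j \<omega>)" for \<omega>
        using slot_server_less by (auto simp: \<Phi>_eq t)
      then show ?thesis by simp
    next
      case True
      have "U K \<omega> = Y i (Suc m) \<omega>" if "\<Phi> t (\<lambda>j. ?Z j \<omega>)" for \<omega>
        using that by (auto simp: \<Phi>_eq t job_service_def slot_service_def dest: job_slot_eq)
      then have "prob {\<omega>\<in>space M. \<Phi> t (\<lambda>j. ?Z j \<omega>) \<and> U K \<omega> \<in> C K} =
          prob {\<omega>\<in>space M. \<Phi> t (\<lambda>j. ?Z j \<omega>) \<and> ?Z (Inr (i, Suc m)) \<omega> \<in> C K}"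
        by (intro arg_cong[where f=prob]) auto
      also have "\<dots> = prob {\<omega>\<in>space M. \<Phi> t (\<lambda>j. ?Z j \<omega>)} * prob {\<omega>\<in>space M. ?Z (Inr (i, Suc m)) \<omega> \<in> C K}"
        using True \<Phi>_unused unfolding t by (intro prob_unused_coordinate[OF indep _ \<Phi>_meas _ C]) auto
      also have "prob {\<omega>\<in>space M. ?Z (Inr (i, Suc m)) \<omega> \<in> C K} = measure D (C K)"
        using True C unfolding law[OF True, symmetric, of m]
        by (subst measure_distr) (auto simp: vimage_def Int_def conj_commute)
      finally show ?thesis .
    qed
  qed
  have "ennreal (prob {\<omega>\<in>space M. (\<forall>j\<in>J. W j \<omega> \<in> B j) \<and> (\<forall>k<Suc K. U k \<omega> \<in> C k)}) =
      prob {\<omega>\<in>space M. R0 \<omega> \<and> U K \<omega> \<in> C K}"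
    unfolding R0_def less_Suc_eq by (intro arg_cong[where f=prob] arg_cong[where f=ennreal]) auto
  also have "\<dots> = (\<integral>\<^sup>+t. prob {\<omega>\<in>space M. \<Phi> t (\<lambda>j. ?Z j \<omega>) \<and> U K \<omega> \<in> C K} \<partial>count_space UNIV)"
    by (rule split) (rule pred_sets2[OF C measurable_job_service])
  also have "\<dots> = (\<integral>\<^sup>+t. prob {\<omega>\<in>space M. \<Phi> t (\<lambda>j. ?Z j \<omega>) \<and> True} * ennreal (measure D (C K)) \<partial>count_space UNIV)"
    unfolding step by (simp add: ennreal_mult)
  also have "\<dots> = prob {\<omega>\<in>space M. R0 \<omega> \<and> True} * ennreal (measure D (C K))"
    by (subst split[of "\<lambda>_. True"]) (simp_all add: nn_integral_multc)
  also have "\<dots> = ennreal (prob {\<omega>\<in>space M. \<forall>j\<in>J. W j \<omega> \<in> B j} * (\<Prod>k<Suc K. measure D (C k)))"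
    using Suc unfolding R0_def by (simp add: Ball_def ennreal_mult prod_nonneg mult.assoc)
  finally show ?case by (simp add: prod_nonneg)
qed simp

lemma U_law: "distr M borel (U k) = D"
proof (rule measure_eqI)
  show "sets (distr M borel (U k)) = sets D" using law[of 0 0] n by (metis Suc_le_eq One_nat_def sets_distr)
  interpret D: prob_space D by (rule D_prob)
  fix B assume "B \<in> sets (distr M borel (U k))"
  then have B: "B \<in> sets borel" by simp
  have "space D = UNIV" using law[of 0 0] n by (metis Suc_le_eq One_nat_def space_distr space_borel)
  then have D_UNIV: "measure D UNIV = 1" using D.prob_space by simp
  let ?C = "\<lambda>j. if j = k then B else UNIV"
  have "prob {\<omega>\<in>space M. U k \<omega> \<in> B} = prob {\<omega>\<in>space M. (\<forall>j\<in>{}. W j \<omega> \<in> UNIV) \<and> (\<forall>j<Suc k. U j \<omega> \<in> ?C j)}"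
    by (intro arg_cong[where f=prob]) auto
  also have "\<dots> = prob {\<omega>\<in>space M. \<forall>j\<in>{}. W j \<omega> \<in> UNIV} * (\<Prod>j<Suc k. measure D (?C j))"
    using B by (intro prob_services) auto
  also have "\<dots> = measure D B"
    by (simp add: prob_space D_UNIV)
  finally show "emeasure (distr M borel (U k)) B = emeasure D B"
    using B by (simp add: emeasure_distr emeasure_eq_measure D.emeasure_eq_measure vimage_def Int_def conj_commute)
qed

theorem indep_primitives: "indep_vars (\<lambda>_. borel) W (UNIV <+> ({..<n} <+> UNIV))"
  unfolding indep_vars_def2
proof (intro conjI ballI W_measurable indep_setsI)
  fix j :: "nat + (nat + nat)" assume j: "j \<in> UNIV <+> ({..<n} <+> UNIV)"
  then show "{W j -` A \<inter> space M |A. A \<in> sets borel} \<subseteq> events"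
    using measurable_sets[OF W_measurable] by blast
next
  fix A :: "nat + (nat + nat) \<Rightarrow> 'b set" and J
  assume "J \<noteq> {}" and J: "J \<subseteq> UNIV <+> ({..<n} <+> UNIV)" and "finite J"
    and A: "\<forall>j\<in>J. A j \<in> {W j -` A \<inter> space M |A. A \<in> sets borel}"
  have "\<forall>j\<in>J. \<exists>B. A j = W j -` B \<inter> space M \<and> B \<in> sets borel" using A by blast
  from bchoice[OF this]
  obtain B0 where B0: "\<And>j. j \<in> J \<Longrightarrow> A j = W j -` B0 j \<inter> space M \<and> B0 j \<in> sets borel" by blast
  define B where "B j = (if j \<in> J then B0 j else UNIV)" for j
  have B: "B j \<in> sets borel" for j using B0 by (simp add: B_def)
  have A_eq: "A j = {\<omega>\<in>space M. W j \<omega> \<in> B j}" if "j \<in> J" for j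
    using B0[OF that] that by (auto simp: B_def)
  interpret D: prob_space D by (rule D_prob)
  have "space D = UNIV" using law[of 0 0] n by (metis Suc_le_eq One_nat_def space_distr space_borel)
  then have D_UNIV: "measure D UNIV = 1" using D.prob_space by simp
  define S where "S = {k. Inr (Inr k) \<in> J}"
  let ?J0 = "J \<inter> initials" and ?e = "\<lambda>k. Inr (Inr k) :: nat + (nat + nat)"
  have J_split: "J = ?J0 \<union> ?e ` S" "?J0 \<inter> ?e ` S = {}"
    using J by (auto simp: S_def)
  have inj: "inj_on ?e S" by (simp add: inj_on_def)
  have "finite (?e ` S)" using \<open>finite J\<close> by (rule finite_subset[rotated]) (auto simp: S_def)
  then have "finite S" using inj by (rule finite_imageD)
  then obtain K where K: "S \<subseteq> {..<K}" using finite_nat_bounded by blast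
  have "(\<Inter>j\<in>J. A j) = {\<omega>\<in>space M. (\<forall>j\<in>?J0. W j \<omega> \<in> B j) \<and> (\<forall>k<K. U k \<omega> \<in> B (Inr (Inr k)))}"
  proof -
    have "(\<Inter>j\<in>J. A j) = {\<omega>\<in>space M. \<forall>j\<in>J. W j \<omega> \<in> B j}"
      using A_eq \<open>J \<noteq> {}\<close> by auto
    also have "\<dots> = {\<omega>\<in>space M. (\<forall>j\<in>?J0. W j \<omega> \<in> B j) \<and> (\<forall>k\<in>S. W (Inr (Inr k)) \<omega> \<in> B (Inr (Inr k)))}"
    proof -
      have "j \<in> ?J0 \<or> (\<exists>k\<in>S. j = ?e k)" if "j \<in> J" for j using J_split(1) that by blast
      then show ?thesis by (fastforce simp: S_def)
    qed
    also have "\<dots> = {\<omega>\<in>space M. (\<forall>j\<in>?J0. W j \<omega> \<in> B j) \<and> (\<forall>k<K. U k \<omega> \<in> B (Inr (Inr k)))}"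
      using K by (auto simp: S_def B_def)
    finally show ?thesis .
  qed
  then have "prob (\<Inter>j\<in>J. A j) =
      prob {\<omega>\<in>space M. \<forall>j\<in>?J0. W j \<omega> \<in> B j} * (\<Prod>k<K. measure D (B (Inr (Inr k))))"
    using \<open>finite J\<close> B by (simp only:) (rule prob_services; auto)
  also have "prob {\<omega>\<in>space M. \<forall>j\<in>?J0. W j \<omega> \<in> B j} = (\<Prod>j\<in>?J0. prob (A j))"
  proof (cases "?J0 = {}")
    case False
    have "prob (\<Inter>j\<in>?J0. W j -` B j \<inter> space M) = (\<Prod>j\<in>?J0. prob (W j -` B j \<inter> space M))"
      using \<open>finite J\<close> B by (intro indep_varsD[OF indep_initials False]) auto
    moreover have "(\<Inter>j\<in>?J0. W j -` B j \<inter> space M) = {\<omega>\<in>space M. \<forall>j\<in>?J0. W j \<omega> \<in> B j}"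
      using False by auto
    moreover have "W j -` B j \<inter> space M = A j" if "j \<in> J" for j using A_eq[OF that] by auto
    ultimately show ?thesis by simp
  next
    case True
    then show ?thesis by (simp add: prob_space)
  qed
  also have "(\<Prod>k<K. measure D (B (Inr (Inr k)))) = (\<Prod>k\<in>S. measure D (B (Inr (Inr k))))"
    using K by (intro prod.mono_neutral_right) (auto simp: S_def B_def D_UNIV)
  also have "\<dots> = (\<Prod>k\<in>S. prob (A (Inr (Inr k))))"
  proof (rule prod.cong)
    fix k assume "k \<in> S"
    then have "A (Inr (Inr k)) = U k -` B (Inr (Inr k)) \<inter> space M"
      by (subst A_eq) (auto simp: S_def)
    then show "measure D (B (Inr (Inr k))) = prob (A (Inr (Inr k)))"
      unfolding U_law[of k, symmetric] using B by (simp add: measure_distr)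
  qed simp
  also have "\<dots> = (\<Prod>j\<in>?e ` S. prob (A j))"
    by (simp add: prod.reindex[OF inj])
  also have "(\<Prod>j\<in>?J0. prob (A j)) * \<dots> = (\<Prod>j\<in>J. prob (A j))"
    using J_split \<open>finite J\<close> \<open>finite S\<close> by (metis finite_Int finite_imageI prod.union_disjoint)
  finally show "prob (\<Inter>j\<in>J. A j) = (\<Prod>j\<in>J. prob (A j))" .
qed

end

section \<open>The law of the residual life\<close>

lemma nn_integral_tail:
  fixes X :: "'p \<Rightarrow> real"
  assumes "prob_space P" and X[measurable]: "X \<in> borel_measurable P"
  shows "(\<integral>\<^sup>+y. ennreal (measure P {\<omega>\<in>space P. X \<omega> > y}) * indicator {0<..} y \<partial>lborel) = (\<integral>\<^sup>+\<omega>. ennreal (X \<omega>) \<partial>P)"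
proof -
  interpret P: prob_space P by fact
  interpret pair_sigma_finite P lborel ..
  have "(\<integral>\<^sup>+y. ennreal (measure P {\<omega>\<in>space P. X \<omega> > y}) * indicator {0<..} y \<partial>lborel) =
      (\<integral>\<^sup>+y. (\<integral>\<^sup>+\<omega>. indicator {0<..<X \<omega>} y \<partial>P) \<partial>lborel)"
  proof (intro nn_integral_cong)
    fix y :: real
    have "(\<integral>\<^sup>+\<omega>. indicator {0<..<X \<omega>} y \<partial>P) = (\<integral>\<^sup>+\<omega>. indicator {\<omega>\<in>space P. X \<omega> > y} \<omega> * indicator {0<..} y \<partial>P)"
      by (intro nn_integral_cong) (auto split: split_indicator)
    also have "\<dots> = emeasure P {\<omega>\<in>space P. X \<omega> > y} * indicator {0<..} y"
      by (simp add: nn_integral_multc)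
    finally show "ennreal (measure P {\<omega>\<in>space P. X \<omega> > y}) * indicator {0<..} y =
        (\<integral>\<^sup>+\<omega>. indicator {0<..<X \<omega>} y \<partial>P)"
      by (simp add: P.emeasure_eq_measure)
  qed
  also have "\<dots> = (\<integral>\<^sup>+\<omega>. (\<integral>\<^sup>+y. indicator {0<..<X \<omega>} y \<partial>lborel) \<partial>P)"
  proof (rule Fubini')
    show "(\<lambda>(\<omega>, y). indicator {0<..<X \<omega>} y :: ennreal) \<in> borel_measurable (P \<Otimes>\<^sub>M lborel)"
      unfolding indicator_def greaterThanLessThan_iff by measurable
  qed
  also have "\<dots> = (\<integral>\<^sup>+\<omega>. ennreal (X \<omega>) \<partial>P)"
  proof (intro nn_integral_cong)
    show "(\<integral>\<^sup>+y. indicator {0<..<X \<omega>} y \<partial>lborel) = ennreal (X \<omega>)" for \<omega>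
      by (cases "0 \<le> X \<omega>") (auto simp: ennreal_neg)
  qed
  finally show ?thesis .
qed

definition equilibrium_law :: "real measure \<Rightarrow> real \<Rightarrow> real measure" where
  "equilibrium_law D \<mu> = density lborel (\<lambda>y. ennreal (indicator {0<..} y * measure D {y<..} / \<mu>))"

lemma tail_measurable:
  assumes "prob_space D" "sets D = sets borel"
  shows "(\<lambda>y::real. measure D {y<..}) \<in> borel_measurable borel"
proof -
  interpret prob_space D by fact
  have "mono (\<lambda>y. - measure D {y<..})"
    by (intro monoI) (auto intro!: finite_measure_mono simp: assms(2))
  from borel_measurable_mono[OF this] show ?thesis by simp
qed

text \<open>The tail formula holds for \<open>z \<ge> 0\<close> only. At \<open>z = 0\<close> it gives total mass \<open>1\<close> to the positive
  half-line, because the tail integrates to the mean.\<close>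

lemma residual_life_law:
  fixes X :: "'p \<Rightarrow> real"
  assumes M: "prob_space M" and P: "prob_space P" and int: "integrable P X" and nonneg: "AE \<omega> in P. X \<omega> \<ge> 0"
    and mean: "integral\<^sup>L P X > 0" and R: "residual_life M R P X"
  shows "distr M borel R = equilibrium_law (distr P borel X) (integral\<^sup>L P X)"
proof -
  interpret M: prob_space M by fact
  interpret P: prob_space P by fact
  let ?\<mu> = "integral\<^sup>L P X" and ?G = "\<lambda>y. measure P {\<omega>\<in>space P. X \<omega> > y}"
  have X[measurable]: "X \<in> borel_measurable P" using int by simp
  have R_meas[measurable]: "R \<in> borel_measurable M" using R by (simp add: residual_life_def)
  have G: "measure (distr P borel X) {y<..} = ?G y" for y
    by (simp add: measure_distr vimage_def Int_def conj_commute)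
  have G_meas[measurable]: "?G \<in> borel_measurable borel"
    using tail_measurable[of "distr P borel X"] P.prob_space_distr[OF X] by (simp add: G)
  have total: "(\<integral>\<^sup>+y. ennreal (?G y) * indicator {0<..} y \<partial>lborel) = ennreal ?\<mu>"
    unfolding nn_integral_tail[OF P X] by (rule nn_integral_eq_integral[OF int nonneg])
  have int_tail: "(\<integral>\<^sup>+y. ennreal (?G y) * indicator {z<..} y \<partial>lborel) = ennreal (LBINT y:{z<..}. ?G y)"
    if "z \<ge> 0" for z
  proof -
    have "(\<integral>\<^sup>+y. ennreal (?G y) * indicator {z<..} y \<partial>lborel) \<le> (\<integral>\<^sup>+y. ennreal (?G y) * indicator {0<..} y \<partial>lborel)"
      using that by (intro nn_integral_mono) (auto split: split_indicator)
    also have "\<dots> < \<infinity>" unfolding total by simp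
    finally have fin: "(\<integral>\<^sup>+y. ennreal (?G y) * indicator {z<..} y \<partial>lborel) < \<infinity>" .
    have eq: "ennreal (?G y) * indicator {z<..} y = ennreal (indicator {z<..} y *\<^sub>R ?G y)" for y
      by (auto split: split_indicator)
    have "integrable lborel (\<lambda>y. indicator {z<..} y *\<^sub>R ?G y)"
      by (rule integrableI_nonneg) (use fin in \<open>simp_all add: eq\<close>)
    then show ?thesis
      unfolding eq set_lebesgue_integral_def by (intro nn_integral_eq_integral) auto
  qed
  have D0: "emeasure (equilibrium_law (distr P borel X) ?\<mu>) {z<..} =
      (\<integral>\<^sup>+y. ennreal (?G y) * indicator {max 0 z<..} y \<partial>lborel) / ennreal ?\<mu>" for z
  proof -
    have "emeasure (equilibrium_law (distr P borel X) ?\<mu>) {z<..} =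
        (\<integral>\<^sup>+y. ennreal (indicator {0<..} y * ?G y / ?\<mu>) * indicator {z<..} y \<partial>lborel)"
      unfolding equilibrium_law_def G by (subst emeasure_density) auto
    also have "\<dots> = (\<integral>\<^sup>+y. ennreal (?G y) * indicator {max 0 z<..} y / ennreal ?\<mu> \<partial>lborel)"
      using mean by (intro nn_integral_cong) (auto simp: divide_ennreal split: split_indicator)
    finally show ?thesis by (simp add: nn_integral_divide)
  qed
  have tail: "emeasure (distr M borel R) {z<..} = (\<integral>\<^sup>+y. ennreal (?G y) * indicator {z<..} y \<partial>lborel) / ennreal ?\<mu>"
    if "z \<ge> 0" for z
  proof -
    have "emeasure (distr M borel R) {z<..} = ennreal (measure M {\<omega>\<in>space M. R \<omega> > z})"
      by (simp add: emeasure_distr M.emeasure_eq_measure vimage_def Int_def conj_commute)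
    also have "\<dots> = ennreal (LBINT y:{z<..}. ?G y) / ennreal ?\<mu>"
      using R that mean unfolding residual_life_def
      by (simp add: divide_ennreal set_lebesgue_integral_def integral_nonneg_AE)
    finally show ?thesis using int_tail[OF that] by simp
  qed
  interpret R: prob_space "distr M borel R" by (rule M.prob_space_distr) simp
  have "emeasure (distr M borel R) {0<..} = 1"
    unfolding tail[OF order_refl] total using mean by (simp add: ennreal_divide_self)
  then have one: "emeasure (distr M borel R) {z<..} = 1" if "z \<le> 0" for z
    using emeasure_mono[of "{0<..}" "{z<..}" "distr M borel R"] that R.emeasure_le_1[of "{z<..}"]
    by (intro antisym) auto
  show ?thesis
  proof (rule measure_eqI_lessThan)
    fix z
    show "emeasure (distr M borel R) {z<..} = emeasure (equilibrium_law (distr P borel X) ?\<mu>) {z<..}"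
      using one[of z] tail[of z] tail[of 0] one[of 0] D0[of z] by (cases "z \<le> 0") (auto simp: max_def)
    show "emeasure (distr M borel R) {z<..} < \<infinity>" using R.emeasure_le_1[of "{z<..}"] by (simp add: less_top[symmetric] top_unique) 
  qed (auto simp: equilibrium_law_def)
qed

section \<open>Renewal processes do not explode\<close>

lemma event_time_mono:
  assumes "\<And>k. 0 \<le> T k \<omega>" "j \<le> k"
  shows "event_time T j \<omega> \<le> event_time T k \<omega>"
  unfolding event_time_def using assms by (intro sum_mono2) auto

text \<open>By Markov's inequality, the probability that \<open>k\<close> events after the first one happen by time \<open>t\<close>
  is at most \<open>exp t * q ^ k\<close>, where \<open>q < 1\<close> is the mean of \<open>exp (- y)\<close> under \<open>D\<close>.\<close>

lemma (in prob_space) event_times_unbounded: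
  assumes indep: "indep_vars (\<lambda>_. borel) T UNIV"
    and nonneg: "\<And>k \<omega>. \<omega> \<in> space M \<Longrightarrow> 0 \<le> T k \<omega>"
    and law: "\<And>k. distr M borel (T (Suc k)) = D" and pos: "AE y in D. 0 < y"
  shows "AE \<omega> in M. \<forall>t. \<exists>k. t < event_time T k \<omega>"
proof -
  have T[measurable]: "T k \<in> borel_measurable M" for k
    using indep unfolding indep_vars_def by auto
  have e[measurable]: "event_time T k \<in> borel_measurable M" for k
    unfolding event_time_def[abs_def] by measurable
  define q where "q = expectation (\<lambda>\<omega>. exp (- T (Suc 0) \<omega>))"
  have integ: "integrable M (\<lambda>\<omega>. exp (- T k \<omega>))" for k
    by (rule integrable_const_bound[of _ 1]) (auto simp: nonneg)
  have "AE \<omega> in M. 0 < T (Suc 0) \<omega>"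
    using pos unfolding law[of 0, symmetric] by (simp add: AE_distr_iff)
  then have q_less: "q < 1"
    unfolding q_def by (intro expectation_less integ) auto
  have q_nonneg: "0 \<le> q" unfolding q_def by simp
  have factor: "(\<integral>\<^sup>+\<omega>. ennreal (exp (- T (Suc k) \<omega>)) \<partial>M) = ennreal q" for k
  proof -
    have "(\<integral>\<^sup>+\<omega>. ennreal (exp (- T j \<omega>)) \<partial>M) = (\<integral>\<^sup>+y. ennreal (exp (- y)) \<partial>distr M borel (T j))" for j
      by (simp add: nn_integral_distr)
    then show ?thesis
      unfolding q_def using integ[of "Suc 0"] law[of k] law[of 0]
      by (simp add: nn_integral_eq_integral[symmetric])
  qed
  have bound: "prob {\<omega>\<in>space M. event_time T k \<omega> \<le> t} \<le> exp t * q ^ k" for k t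
  proof -
    have "emeasure M {\<omega>\<in>space M. event_time T k \<omega> \<le> t} = (\<integral>\<^sup>+\<omega>. indicator {\<omega>\<in>space M. event_time T k \<omega> \<le> t} \<omega> \<partial>M)"
      by simp
    also have "\<dots> \<le> (\<integral>\<^sup>+\<omega>. ennreal (exp t) * (\<Prod>j\<in>{1..k}. ennreal (exp (- T j \<omega>))) \<partial>M)"
    proof (intro nn_integral_mono)
      fix \<omega> assume \<omega>: "\<omega> \<in> space M"
      have "(\<Sum>j\<in>{1..k}. T j \<omega>) \<le> event_time T k \<omega>"
        unfolding event_time_def using nonneg[OF \<omega>] by (intro sum_mono2) auto
      then have "1 \<le> exp t * (\<Prod>j\<in>{1..k}. exp (- T j \<omega>))" if "event_time T k \<omega> \<le> t"
        using that by (simp add: exp_sum[symmetric] exp_add[symmetric] sum_negf)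
      then have "1 \<le> ennreal (exp t) * (\<Prod>j\<in>{1..k}. ennreal (exp (- T j \<omega>)))" if "event_time T k \<omega> \<le> t"
        using that by (simp add: prod_ennreal ennreal_mult[symmetric] prod_nonneg)
      then show "indicator {\<omega>\<in>space M. event_time T k \<omega> \<le> t} \<omega> \<le> ennreal (exp t) * (\<Prod>j\<in>{1..k}. ennreal (exp (- T j \<omega>)))"
        by (auto split: split_indicator)
    qed
    also have "\<dots> = ennreal (exp t) * (\<integral>\<^sup>+\<omega>. (\<Prod>j\<in>{1..k}. ennreal (exp (- T j \<omega>))) \<partial>M)"
      by (rule nn_integral_cmult) measurable
    also have "(\<integral>\<^sup>+\<omega>. (\<Prod>j\<in>{1..k}. ennreal (exp (- T j \<omega>))) \<partial>M) = (\<Prod>j\<in>{1..k}. \<integral>\<^sup>+\<omega>. ennreal (exp (- T j \<omega>)) \<partial>M)"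
      by (rule indep_vars_nn_integral)
        (auto intro!: indep_vars_compose2[OF indep_vars_subset[OF indep], where Y="\<lambda>_ x. ennreal (exp (- x))"])
    also have "\<dots> = (\<Prod>j\<in>{1..k}. ennreal q)"
    proof (rule prod.cong)
      fix j assume "j \<in> {1..k}"
      then show "(\<integral>\<^sup>+\<omega>. ennreal (exp (- T j \<omega>)) \<partial>M) = ennreal q" using factor[of "j - 1"] by simp
    qed simp
    also have "\<dots> = ennreal (q ^ k)" by (simp add: ennreal_power q_nonneg)
    finally show ?thesis by (simp add: emeasure_eq_measure ennreal_mult[symmetric] q_nonneg)
  qed
  have "AE \<omega> in M. \<exists>k. t < event_time T k \<omega>" for t
  proof -
    have "prob {\<omega>\<in>space M. \<forall>k. event_time T k \<omega> \<le> t} \<le> exp t * q ^ k" for k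
      by (rule order_trans[OF finite_measure_mono bound[of k t]]) auto
    moreover have "(\<lambda>k. exp t * q ^ k) \<longlonglongrightarrow> exp t * 0"
      by (intro tendsto_intros LIMSEQ_realpow_zero q_nonneg q_less)
    ultimately have "prob {\<omega>\<in>space M. \<forall>k. event_time T k \<omega> \<le> t} \<le> 0"
      by (intro LIMSEQ_le_const[of "\<lambda>k. exp t * q ^ k"]) auto
    then have "prob {\<omega>\<in>space M. \<forall>k. event_time T k \<omega> \<le> t} = 0" using measure_nonneg antisym by blast
    then have "AE \<omega> in M. \<not> (\<forall>k. event_time T k \<omega> \<le> t)"
      by (subst AE_iff_measurable[OF _ refl]) (auto simp: emeasure_eq_measure)
    then show ?thesis by (simp add: not_le)
  qed
  then have "AE \<omega> in M. \<forall>m::nat. \<exists>k. real m < event_time T k \<omega>" by (simp add: AE_all_countable)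
  then show ?thesis
  proof eventually_elim
    case (elim \<omega>)
    show ?case
    proof
      fix t
      obtain m :: nat where "t \<le> real m" using real_arch_simple by blast
      with elim show "\<exists>k. t < event_time T k \<omega>" by (meson le_less_trans)
    qed
  qed
qed

section \<open>Time reversal of an equilibrium renewal process\<close>

locale equilibrium_renewal = prob_space M for M :: "'a measure" +
  fixes T :: "nat \<Rightarrow> 'a \<Rightarrow> real" and D :: "real measure" and \<mu> :: real
  assumes indep: "indep_vars (\<lambda>_. borel) T UNIV"
    and nonneg: "\<And>k \<omega>. \<omega> \<in> space M \<Longrightarrow> 0 \<le> T k \<omega>"
    and first_law: "distr M borel (T 0) = equilibrium_law D \<mu>"
    and law: "\<And>k. distr M borel (T (Suc k)) = D"
    and D_pos: "AE y in D. 0 < y"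
    and mu_pos: "0 < \<mu>"
begin

lemma T_measurable[measurable]: "T k \<in> borel_measurable M"
  using indep unfolding indep_vars_def by auto

lemma event_time_measurable[measurable]: "event_time T k \<in> borel_measurable M"
  unfolding event_time_def[abs_def] by measurable

lemma unbounded: "AE \<omega> in M. \<forall>t. \<exists>k. t < event_time T k \<omega>"
  by (rule event_times_unbounded[OF indep nonneg law D_pos])

lemma prob_D: "prob_space D"
  using prob_space_distr[OF T_measurable[of 1]] law[of 0] by simp

lemma sets_D: "sets D = sets borel"
  using law[of 0] by (metis sets_distr)

text \<open>Integrals over the event of exactly \<open>Suc p\<close> events in \<open>[0, t]\<close>. The first event has density
  \<open>G / \<mu>\<close>, the \<open>p\<close> inter-event times \<open>w\<close> that follow have the product law, and \<open>G\<close> of the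
  remaining distance to \<open>t\<close> is the probability that no further event happens by \<open>t\<close>.\<close>

lemma epochs_formula:
  assumes h[measurable]: "h \<in> borel_measurable (PiM {..p} (\<lambda>_. borel))"
  defines "s \<equiv> \<lambda>w. \<Sum>l\<in>{1..p}. w l :: real" and "G \<equiv> \<lambda>y. measure D {y<..}"
  shows "(\<integral>\<^sup>+\<omega>. h (\<lambda>k\<in>{..p}. event_time T k \<omega>) *
        indicator {\<omega>. event_time T p \<omega> \<le> t \<and> t < event_time T (Suc p) \<omega>} \<omega> \<partial>M) =
      (\<integral>\<^sup>+w. (\<integral>\<^sup>+u. ennreal (indicator {0<..} u * indicator {u..} (t - s w) * G u * G (t - s w - u) / \<mu>) *
        h (\<lambda>k\<in>{..p}. u + (\<Sum>l\<in>{1..k}. w l)) \<partial>lborel) \<partial>PiM {1..p} (\<lambda>_. D))"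
proof -
  interpret D: prob_space D by (rule prob_D)
  let ?L = "\<lambda>k::nat. if k = 0 then equilibrium_law D \<mu> else D"
  have L: "distr M borel (T k) = ?L k" for k
    using first_law law[of "k - 1"] by (cases k) auto
  have prob_L: "prob_space (?L k)" for k
    using prob_space_distr[OF T_measurable[of k]] L[of k] by simp
  interpret L: product_prob_space ?L UNIV
    by (intro product_prob_spaceI prob_L)
  have sets_L: "sets (?L k) = sets borel" for k
    using L[of k] by (metis sets_distr)
  let ?I = "insert (Suc p) (insert 0 {1..p})"
  let ?E = "\<lambda>z k. \<Sum>j\<le>k. z j :: real"
  define \<Phi> where "\<Phi> z = h (\<lambda>k\<in>{..p}. ?E z k) * indicator {z. ?E z p \<le> t \<and> t < ?E z (Suc p)} z" for z
  have sets_PiM: "sets (PiM I ?L) = sets (PiM I (\<lambda>_. borel))" for I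
    by (rule sets_PiM_cong) (use sets_L in auto)
  have \<Phi>_meas: "\<Phi> \<in> borel_measurable (PiM ?I (\<lambda>_. borel))"
  proof -
    have E_meas: "(\<lambda>z. ?E z k) \<in> borel_measurable (PiM ?I (\<lambda>_. borel))" if "k \<le> Suc p" for k
      using that by (intro borel_measurable_sum measurable_component_singleton) auto
    note [measurable] = E_meas[of p, OF le_SucI[OF order_refl]] E_meas[of "Suc p", OF order_refl]
    have "(\<lambda>z. \<lambda>k\<in>{..p}. ?E z k) \<in> measurable (PiM ?I (\<lambda>_. borel)) (PiM {..p} (\<lambda>_. borel))"
      by (rule measurable_restrict, rule E_meas) simp
    from measurable_compose[OF this h]
    have "(\<lambda>z. h (\<lambda>k\<in>{..p}. ?E z k)) \<in> borel_measurable (PiM ?I (\<lambda>_. borel))" .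
    moreover have "(\<lambda>z. indicator {z. ?E z p \<le> t \<and> t < ?E z (Suc p)} z :: ennreal) \<in> borel_measurable (PiM ?I (\<lambda>_. borel))"
      unfolding indicator_def mem_Collect_eq by measurable
    ultimately show ?thesis unfolding \<Phi>_def[abs_def] by (rule borel_measurable_times_ennreal)
  qed
  have "distr M (PiM ?I (\<lambda>_. borel)) (\<lambda>\<omega>. \<lambda>i\<in>?I. T i \<omega>) = PiM ?I (\<lambda>i. distr M borel (T i))"
    by (rule indep_vars_iff_distr_eq_PiM[THEN iffD1]) (auto intro: indep_vars_subset[OF indep])
  then have joint: "distr M (PiM ?I (\<lambda>_. borel)) (\<lambda>\<omega>. \<lambda>i\<in>?I. T i \<omega>) = PiM ?I ?L"
    unfolding L .
  have "(\<integral>\<^sup>+\<omega>. h (\<lambda>k\<in>{..p}. event_time T k \<omega>) *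
        indicator {\<omega>. event_time T p \<omega> \<le> t \<and> t < event_time T (Suc p) \<omega>} \<omega> \<partial>M) =
      (\<integral>\<^sup>+\<omega>. \<Phi> (\<lambda>i\<in>?I. T i \<omega>) \<partial>M)"
  proof (rule nn_integral_cong)
    fix \<omega>
    have E: "?E (\<lambda>i\<in>?I. T i \<omega>) k = event_time T k \<omega>" if "k \<le> Suc p" for k
      unfolding event_time_def using that by (intro sum.cong) auto
    have E_list: "(\<lambda>k\<in>{..p}. ?E (\<lambda>i\<in>?I. T i \<omega>) k) = (\<lambda>k\<in>{..p}. event_time T k \<omega>)"
      by (intro restrict_ext E) simp
    show "h (\<lambda>k\<in>{..p}. event_time T k \<omega>) *
        indicator {\<omega>. event_time T p \<omega> \<le> t \<and> t < event_time T (Suc p) \<omega>} \<omega> = \<Phi> (\<lambda>i\<in>?I. T i \<omega>)"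
      unfolding \<Phi>_def indicator_def mem_Collect_eq E_list
        E[of p, OF le_SucI[OF order_refl]] E[of "Suc p", OF order_refl] ..
  qed
  also have "\<dots> = (\<integral>\<^sup>+z. \<Phi> z \<partial>PiM ?I ?L)"
    unfolding joint[symmetric]
    by (intro nn_integral_distr[symmetric] measurable_restrict T_measurable)
      (simp only: measurable_distr_eq1 \<Phi>_meas)
  also have "\<dots> = (\<integral>\<^sup>+w'. (\<integral>\<^sup>+v. \<Phi> (w'(Suc p := v)) \<partial>?L (Suc p)) \<partial>PiM (insert 0 {1..p}) ?L)"
  proof (rule L.product_nn_integral_insert)
    show "\<Phi> \<in> borel_measurable (PiM ?I ?L)"
      unfolding measurable_cong_sets[OF sets_PiM refl] by (rule \<Phi>_meas)
  qed auto
  also have "\<dots> = (\<integral>\<^sup>+w'. h (\<lambda>k\<in>{..p}. ?E w' k) * indicator {..t} (?E w' p) * ennreal (G (t - ?E w' p)) \<partial>PiM (insert 0 {1..p}) ?L)"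
  proof (rule nn_integral_cong)
    fix w'
    have E: "?E (w'(Suc p := v)) k = ?E w' k" if "k \<le> p" for v k
      using that by (intro sum.cong) auto
    have E_list: "(\<lambda>k\<in>{..p}. ?E (w'(Suc p := v)) k) = (\<lambda>k\<in>{..p}. ?E w' k)" for v
      by (intro restrict_ext E) simp
    have "\<Phi> (w'(Suc p := v)) = h (\<lambda>k\<in>{..p}. ?E w' k) * indicator {..t} (?E w' p) * indicator {t - ?E w' p<..} v" for v
      unfolding \<Phi>_def E_list using E[of p v] by (auto simp: indicator_def)
    then show "(\<integral>\<^sup>+v. \<Phi> (w'(Suc p := v)) \<partial>?L (Suc p)) = h (\<lambda>k\<in>{..p}. ?E w' k) * indicator {..t} (?E w' p) * ennreal (G (t - ?E w' p))"
      by (simp add: nn_integral_cmult_indicator sets_D G_def D.emeasure_eq_measure)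
  qed
  also have "\<dots> = (\<integral>\<^sup>+w. (\<integral>\<^sup>+u. h (\<lambda>k\<in>{..p}. ?E (w(0 := u)) k) * indicator {..t} (?E (w(0 := u)) p) * ennreal (G (t - ?E (w(0 := u)) p)) \<partial>?L 0) \<partial>PiM {1..p} ?L)"
  proof (rule L.product_nn_integral_insert)
    have E_meas: "(\<lambda>z. ?E z k) \<in> borel_measurable (PiM (insert 0 {1..p}) (\<lambda>_. borel))" if "k \<le> p" for k
      using that by (intro borel_measurable_sum measurable_component_singleton) auto
    note [measurable] = E_meas[of p, OF order_refl]
    have [measurable]: "(\<lambda>z. \<lambda>k\<in>{..p}. ?E z k) \<in> measurable (PiM (insert 0 {1..p}) (\<lambda>_. borel)) (PiM {..p} (\<lambda>_. borel))"
      by (rule measurable_restrict, rule E_meas) simp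
    have [measurable]: "G \<in> borel_measurable borel"
      unfolding G_def by (rule tail_measurable[OF prob_D sets_D])
    show "(\<lambda>w'. h (\<lambda>k\<in>{..p}. ?E w' k) * indicator {..t} (?E w' p) * ennreal (G (t - ?E w' p))) \<in> borel_measurable (PiM (insert 0 {1..p}) ?L)"
      unfolding measurable_cong_sets[OF sets_PiM refl] by measurable
  qed auto
  also have "\<dots> = (\<integral>\<^sup>+w. (\<integral>\<^sup>+u. ennreal (indicator {0<..} u * indicator {u..} (t - s w) * G u * G (t - s w - u) / \<mu>) *
        h (\<lambda>k\<in>{..p}. u + (\<Sum>l\<in>{1..k}. w l)) \<partial>lborel) \<partial>PiM {1..p} ?L)"
  proof (rule nn_integral_cong)
    fix w :: "nat \<Rightarrow> real"
    have [measurable]: "G \<in> borel_measurable borel"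
      unfolding G_def by (rule tail_measurable[OF prob_D sets_D])
    have E: "?E (w(0 := u)) k = u + (\<Sum>l\<in>{1..k}. w l)" for u k
    proof -
      have "?E (w(0 := u)) k = (\<Sum>j\<in>insert 0 {1..k}. (w(0 := u)) j)" by (rule sum.cong) auto
      also have "\<dots> = u + (\<Sum>j\<in>{1..k}. (w(0 := u)) j)" by simp
      also have "(\<Sum>j\<in>{1..k}. (w(0 := u)) j) = (\<Sum>l\<in>{1..k}. w l)" by (rule sum.cong) auto
      finally show ?thesis .
    qed
    have [measurable]: "(\<lambda>u. \<lambda>k\<in>{..p}. u + (\<Sum>l\<in>{1..k}. w l)) \<in> measurable borel (PiM {..p} (\<lambda>_. borel))"
      by (intro measurable_restrict) auto
    have "(\<integral>\<^sup>+u. h (\<lambda>k\<in>{..p}. ?E (w(0 := u)) k) * indicator {..t} (?E (w(0 := u)) p) * ennreal (G (t - ?E (w(0 := u)) p)) \<partial>?L 0) =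
      (\<integral>\<^sup>+u. ennreal (indicator {0<..} u * G u / \<mu>) *
        (h (\<lambda>k\<in>{..p}. u + (\<Sum>l\<in>{1..k}. w l)) * indicator {..t} (u + s w) * ennreal (G (t - (u + s w)))) \<partial>lborel)"
    proof -
      have L0: "?L 0 = density lborel (\<lambda>u. ennreal (indicator {0<..} u * G u / \<mu>))"
        by (simp add: equilibrium_law_def G_def)
      show ?thesis
        unfolding L0 E s_def by (rule nn_integral_density) measurable
    qed
    also have "\<dots> = (\<integral>\<^sup>+u. ennreal (indicator {0<..} u * indicator {u..} (t - s w) * G u * G (t - s w - u) / \<mu>) *
        h (\<lambda>k\<in>{..p}. u + (\<Sum>l\<in>{1..k}. w l)) \<partial>lborel)"
    proof (rule nn_integral_cong)
      fix u
      have sw: "t - s w - u = t - (u + s w)" by simp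
      have "0 \<le> G y" for y unfolding G_def by simp
      then have "ennreal (G u * G (t - s w - u) / \<mu>) = ennreal (G u / \<mu>) * ennreal (G (t - (u + s w)))"
        unfolding sw using mu_pos by (simp add: ennreal_mult[symmetric])
      then show "ennreal (indicator {0<..} u * G u / \<mu>) *
        (h (\<lambda>k\<in>{..p}. u + (\<Sum>l\<in>{1..k}. w l)) * indicator {..t} (u + s w) * ennreal (G (t - (u + s w)))) =
        ennreal (indicator {0<..} u * indicator {u..} (t - s w) * G u * G (t - s w - u) / \<mu>) *
        h (\<lambda>k\<in>{..p}. u + (\<Sum>l\<in>{1..k}. w l))"
        by (auto simp: indicator_def mult_ac)
    qed
    finally show "(\<integral>\<^sup>+u. h (\<lambda>k\<in>{..p}. ?E (w(0 := u)) k) * indicator {..t} (?E (w(0 := u)) p) * ennreal (G (t - ?E (w(0 := u)) p)) \<partial>?L 0) =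
      (\<integral>\<^sup>+u. ennreal (indicator {0<..} u * indicator {u..} (t - s w) * G u * G (t - s w - u) / \<mu>) *
        h (\<lambda>k\<in>{..p}. u + (\<Sum>l\<in>{1..k}. w l)) \<partial>lborel)" .
  qed
  also have "PiM {1..p} ?L = PiM {1..p} (\<lambda>_. D)"
    by (rule PiM_cong) auto
  finally show ?thesis .
qed

text \<open>Reversal exchanges the distance \<open>u\<close> from \<open>0\<close> to the first event with the distance
  \<open>t - s w - u\<close> from the last event to \<open>t\<close>, and reverses the order of \<open>w\<close>. The density in \<open>u\<close> is
  symmetric under the exchange, up to the null set where one of the distances is \<open>0\<close>, and the
  law of \<open>w\<close> is exchangeable.\<close>

theorem epochs_reversed:
  assumes h[measurable]: "h \<in> borel_measurable (PiM {..p} (\<lambda>_. borel))"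
  shows "(\<integral>\<^sup>+\<omega>. h (\<lambda>k\<in>{..p}. t - event_time T (p - k) \<omega>) *
        indicator {\<omega>. event_time T p \<omega> \<le> t \<and> t < event_time T (Suc p) \<omega>} \<omega> \<partial>M) =
      (\<integral>\<^sup>+\<omega>. h (\<lambda>k\<in>{..p}. event_time T k \<omega>) *
        indicator {\<omega>. event_time T p \<omega> \<le> t \<and> t < event_time T (Suc p) \<omega>} \<omega> \<partial>M)"
proof -
  interpret D: prob_space D by (rule prob_D)
  interpret DD: product_prob_space "\<lambda>_::nat. D" UNIV by (intro product_prob_spaceI prob_D)
  let ?s = "\<lambda>w. \<Sum>l\<in>{1..p}. w l :: real" and ?G = "\<lambda>y. measure D {y<..}"
  let ?K = "\<lambda>w u. ennreal (indicator {0<..} u * indicator {u..} (t - ?s w) * ?G u * ?G (t - ?s w - u) / \<mu>)"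
  let ?e = "\<lambda>w u. \<lambda>k\<in>{..p}. u + (\<Sum>l\<in>{1..k}. w l) :: real"
  let ?P = "PiM {1..p} (\<lambda>_. D)"
  let ?rev = "\<lambda>w. \<lambda>l\<in>{1..p}. w (Suc p - l) :: real"
  let ?h' = "\<lambda>e. h (\<lambda>k\<in>{..p}. t - e (p - k))"
  have h': "?h' \<in> borel_measurable (PiM {..p} (\<lambda>_. borel))"
  proof (rule measurable_compose[OF _ h])
    show "(\<lambda>e. \<lambda>k\<in>{..p}. t - e (p - k) :: real) \<in> measurable (PiM {..p} (\<lambda>_. borel)) (PiM {..p} (\<lambda>_. borel))"
      by (intro measurable_restrict borel_measurable_diff measurable_const measurable_component_singleton) auto
  qed
  have [measurable]: "?G \<in> borel_measurable borel"
    by (rule tail_measurable[OF prob_D sets_D])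
  have e_meas[measurable]: "?e w \<in> measurable borel (PiM {..p} (\<lambda>_. borel))" for w
    by (intro measurable_restrict) auto
  have s_rev: "?s (?rev w) = ?s w" for w
  proof -
    have "?s (?rev w) = (\<Sum>l\<in>{1..p}. w (Suc p - l))" by (intro sum.cong) auto
    also have "\<dots> = ?s w"
      by (rule sum.reindex_bij_witness[of _ "\<lambda>l. Suc p - l" "\<lambda>l. Suc p - l"]) auto
    finally show ?thesis .
  qed
  have e_rev: "(\<lambda>k\<in>{..p}. t - ?e w u (p - k)) = ?e (?rev w) (t - ?s w - u)" for w u
  proof (rule restrict_ext)
    fix k assume "k \<in> {..p}"
    then have k: "k \<le> p" by simp
    have "(\<Sum>l\<in>{1..k}. ?rev w l) = (\<Sum>l\<in>{1..k}. w (Suc p - l))"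
      using k by (intro sum.cong) auto
    also have "\<dots> = (\<Sum>l\<in>{Suc (p - k)..p}. w l)"
      by (rule sum.reindex_bij_witness[of _ "\<lambda>l. Suc p - l" "\<lambda>l. Suc p - l"]) (use k in auto)
    also have "\<dots> = ?s w - (\<Sum>l\<in>{1..p - k}. w l)"
    proof -
      have "{1..p} = {1..p - k} \<union> {Suc (p - k)..p}" using k by auto
      then have "?s w = (\<Sum>l\<in>{1..p - k}. w l) + (\<Sum>l\<in>{Suc (p - k)..p}. w l)"
        by (simp add: sum.union_disjoint)
      then show ?thesis by simp
    qed
    finally show "t - ?e w u (p - k) = t - ?s w - u + (\<Sum>l\<in>{1..k}. ?rev w l)"
      by simp
  qed
  have sets_P: "sets ?P = sets (PiM {1..p} (\<lambda>_. borel))"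
    by (rule sets_PiM_cong) (auto simp: sets_D)
  have [measurable]: "(\<lambda>(w, u). ?e w u) \<in> measurable (?P \<Otimes>\<^sub>M borel) (PiM {..p} (\<lambda>_. borel))"
    unfolding split_beta'
  proof (intro measurable_restrict borel_measurable_add borel_measurable_sum measurable_snd)
    fix k l assume "k \<in> {..p}" "l \<in> {1..k}"
    then have "(\<lambda>w. w l) \<in> measurable ?P borel"
      unfolding measurable_cong_sets[OF sets_P refl] by (intro measurable_component_singleton) auto
    from measurable_compose[OF measurable_fst this]
    show "(\<lambda>x. fst x l) \<in> borel_measurable (?P \<Otimes>\<^sub>M borel)" .
  qed
  have [measurable]: "?s \<in> borel_measurable ?P"
    unfolding measurable_cong_sets[OF sets_P refl]
    by (intro borel_measurable_sum measurable_component_singleton) auto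
  have F_meas: "(\<lambda>w. \<integral>\<^sup>+u. ?K w u * h (?e w u) \<partial>lborel) \<in> borel_measurable ?P"
  proof -
    have "(\<lambda>(w, u). ?K w u * h (?e w u)) \<in> borel_measurable (?P \<Otimes>\<^sub>M lborel)"
      unfolding indicator_def greaterThan_iff atLeast_iff by measurable
    then show ?thesis by (rule lborel.borel_measurable_nn_integral)
  qed
  have swap: "(\<integral>\<^sup>+u. ?K w u * h (?e (?rev w) (t - ?s w - u)) \<partial>lborel) = (\<integral>\<^sup>+u. ?K (?rev w) u * h (?e (?rev w) u) \<partial>lborel)" for w
  proof -
    let ?c = "t - ?s w"
    define F where "F u = ?K w u * h (?e (?rev w) (?c - u))" for u
    have "(\<lambda>u. ?K w u) \<in> borel_measurable borel"
      unfolding indicator_def greaterThan_iff atLeast_iff by measurable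
    moreover have "(\<lambda>u. h (?e (?rev w) (?c - u))) \<in> borel_measurable borel"
      by (rule measurable_compose[OF measurable_compose[OF _ e_meas] h]) measurable
    ultimately have F: "F \<in> borel_measurable borel"
      unfolding F_def[abs_def] by (rule borel_measurable_times_ennreal)
    have "(\<integral>\<^sup>+u. F u \<partial>lborel) = ennreal \<bar>- 1\<bar> * (\<integral>\<^sup>+u. F (?c + - 1 * u) \<partial>lborel)"
      by (rule nn_integral_real_affine[OF F]) simp
    also have "\<dots> = (\<integral>\<^sup>+u. F (?c - u) \<partial>lborel)" by simp
    also have "\<dots> = (\<integral>\<^sup>+u. ?K (?rev w) u * h (?e (?rev w) u) \<partial>lborel)"
    proof (rule nn_integral_cong_AE)
      have "AE u in lborel. u \<noteq> 0 \<and> u \<noteq> ?c"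
        using AE_lborel_singleton[of 0] AE_lborel_singleton[of ?c] by eventually_elim auto
      then show "AE u in lborel. F (?c - u) = ?K (?rev w) u * h (?e (?rev w) u)"
      proof eventually_elim
        case (elim u)
        then have "?K w (?c - u) = ?K (?rev w) u"
          unfolding s_rev by (auto simp: indicator_def mult_ac)
        moreover have "?c - (?c - u) = u" by simp
        ultimately show ?case unfolding F_def by metis
      qed
    qed
    finally show ?thesis unfolding F_def .
  qed
  have exchange: "distr ?P (PiM {1..p} (\<lambda>_. D)) ?rev = ?P"
  proof -
    have "distr (PiM {1..p} (\<lambda>_. D)) (PiM {1..p} (\<lambda>l. D)) (\<lambda>w. \<lambda>l\<in>{1..p}. w (Suc p - l)) = PiM {1..p} (\<lambda>l. D)"
      by (rule distr_PiM_reindex[where f="\<lambda>l. Suc p - l"]) (auto simp: inj_on_def prob_D)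
    then show ?thesis by simp
  qed
  have rev_meas: "?rev \<in> measurable ?P ?P"
    by (intro measurable_restrict measurable_component_singleton) auto
  have "(\<integral>\<^sup>+\<omega>. h (\<lambda>k\<in>{..p}. t - event_time T (p - k) \<omega>) *
        indicator {\<omega>. event_time T p \<omega> \<le> t \<and> t < event_time T (Suc p) \<omega>} \<omega> \<partial>M) =
      (\<integral>\<^sup>+\<omega>. ?h' (\<lambda>k\<in>{..p}. event_time T k \<omega>) *
        indicator {\<omega>. event_time T p \<omega> \<le> t \<and> t < event_time T (Suc p) \<omega>} \<omega> \<partial>M)"
    by (simp cong: restrict_cong)
  also have "\<dots> = (\<integral>\<^sup>+w. (\<integral>\<^sup>+u. ?K w u * ?h' (?e w u) \<partial>lborel) \<partial>?P)"
    by (rule epochs_formula[OF h'])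
  also have "\<dots> = (\<integral>\<^sup>+w. (\<integral>\<^sup>+u. ?K (?rev w) u * h (?e (?rev w) u) \<partial>lborel) \<partial>?P)"
    unfolding e_rev swap ..
  also have "\<dots> = (\<integral>\<^sup>+w. (\<integral>\<^sup>+u. ?K w u * h (?e w u) \<partial>lborel) \<partial>distr ?P ?P ?rev)"
    by (rule nn_integral_distr[symmetric, OF rev_meas]) (simp only: measurable_distr_eq1 F_meas)
  also have "\<dots> = (\<integral>\<^sup>+\<omega>. h (\<lambda>k\<in>{..p}. event_time T k \<omega>) *
        indicator {\<omega>. event_time T p \<omega> \<le> t \<and> t < event_time T (Suc p) \<omega>} \<omega> \<partial>M)"
    unfolding exchange by (rule epochs_formula[OF h, symmetric])
  finally show ?thesis .
qed

text \<open>The events in \<open>[t - q, t]\<close>, as a process in \<open>q\<close>, are counted by the reversed epochs. The claim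
  follows from the previous result by splitting according to the number of events in \<open>[0, t]\<close>.\<close>

theorem counts_reversed:
  "distr M (PiM {0..t} (\<lambda>_. count_space UNIV))
      (\<lambda>\<omega>. \<lambda>q\<in>{0..t}. card {k. t - q \<le> event_time T k \<omega> \<and> event_time T k \<omega> \<le> t}) =
    distr M (PiM {0..t} (\<lambda>_. count_space UNIV)) (\<lambda>\<omega>. \<lambda>q\<in>{0..t}. counting_process T q \<omega>)"
    (is "distr M ?S ?R = distr M ?S ?N")
proof (rule measure_eqI)
  let ?e = "event_time T"
  have R: "?R \<in> measurable M ?S"
    by (intro measurable_restrict measurable_card) measurable
  have N: "?N \<in> measurable M ?S"
    unfolding counting_process_def by (intro measurable_restrict measurable_card) measurable
  \<comment> \<open>Exactly \<open>i\<close> events happen by time \<open>t\<close>.\<close>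
  define En where "En i \<omega> \<longleftrightarrow> (case i of 0 \<Rightarrow> t < ?e 0 \<omega> | Suc p \<Rightarrow> ?e p \<omega> \<le> t \<and> t < ?e (Suc p) \<omega>)" for i \<omega>
  have En[measurable]: "Measurable.pred M (En i)" for i
    unfolding En_def[abs_def] by (cases i) simp_all
  have mono: "?e j \<omega> \<le> ?e k \<omega>" if "\<omega> \<in> space M" "j \<le> k" for j k \<omega>
    by (rule event_time_mono) (use that nonneg in auto)
  have disjoint: "AE \<omega> in M. \<forall>i\<in>UNIV. \<forall>j\<in>UNIV. En i \<omega> \<and> P \<omega> \<longrightarrow> En j \<omega> \<and> P \<omega> \<longrightarrow> i = j" for P
  proof (rule AE_I2, intro ballI impI)
    fix \<omega> i j assume \<omega>: "\<omega> \<in> space M" and "En i \<omega> \<and> P \<omega>" "En j \<omega> \<and> P \<omega>"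
    moreover have "\<not> i < j" if "En i \<omega>" "En j \<omega>" for i j
    proof
      assume "i < j"
      then obtain p where p: "j = Suc p" "i \<le> p" by (cases j) auto
      have "t < ?e i \<omega>" using that(1) by (auto simp: En_def split: nat.splits)
      moreover have "?e p \<omega> \<le> t" using that(2) p by (simp add: En_def)
      ultimately show False using mono[OF \<omega> p(2)] by simp
    qed
    ultimately show "i = j" by (meson linorder_neqE_nat)
  qed
  have exhaustive: "AE \<omega> in M. \<exists>i. En i \<omega>"
    using unbounded
  proof eventually_elim
    case (elim \<omega>)
    let ?i = "LEAST k. t < ?e k \<omega>"
    have "t < ?e ?i \<omega>" by (rule LeastI_ex) (use elim in blast)
    moreover have "?e k \<omega> \<le> t" if "k < ?i" for k using not_less_Least[OF that] by simp
    ultimately have "En ?i \<omega>" unfolding En_def by (cases ?i) auto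
    then show ?case ..
  qed
  fix B assume "B \<in> sets (distr M ?S ?R)"
  then have B: "B \<in> sets ?S" by simp
  have decompose: "ennreal (prob {\<omega>\<in>space M. F \<omega> \<in> B}) = (\<integral>\<^sup>+i. prob {\<omega>\<in>space M. En i \<omega> \<and> F \<omega> \<in> B} \<partial>count_space UNIV)"
    if F: "F \<in> measurable M ?S" for F
  proof -
    note [measurable] = pred_sets2[OF B F]
    have "prob {\<omega>\<in>space M. F \<omega> \<in> B} = prob {\<omega>\<in>space M. \<exists>i\<in>UNIV. En i \<omega> \<and> F \<omega> \<in> B}"
      by (rule prob_eq_AE) (use exhaustive in auto)
    also have "\<dots> = (\<integral>\<^sup>+i. prob {\<omega>\<in>space M. En i \<omega> \<and> F \<omega> \<in> B} \<partial>count_space UNIV)"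
      by (rule prob_EX_countable[OF _ _ disjoint]) auto
    finally show ?thesis .
  qed
  have "prob {\<omega>\<in>space M. En i \<omega> \<and> ?R \<omega> \<in> B} = prob {\<omega>\<in>space M. En i \<omega> \<and> ?N \<omega> \<in> B}" for i
  proof (cases i)
    case 0
    have "?R \<omega> = ?N \<omega>" if "\<omega> \<in> space M" "En i \<omega>" for \<omega>
    proof (rule restrict_ext)
      fix q assume q: "q \<in> {0..t}"
      have late: "t < ?e k \<omega>" for k using mono[OF that(1), of 0 k] that(2) 0 by (simp add: En_def)
      have empty: "{k. t - q \<le> ?e k \<omega> \<and> ?e k \<omega> \<le> t} = {}" "{k. ?e k \<omega> \<le> q} = {}"
        using late q by (auto simp: not_le intro: le_less_trans)
      show "card {k. t - q \<le> ?e k \<omega> \<and> ?e k \<omega> \<le> t} = counting_process T q \<omega>"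
        unfolding counting_process_def empty by (rule refl)
    qed
    then have "{\<omega>\<in>space M. En i \<omega> \<and> ?R \<omega> \<in> B} = {\<omega>\<in>space M. En i \<omega> \<and> ?N \<omega> \<in> B}" by auto
    then show ?thesis by simp
  next
    case (Suc p)
    define cnt where "cnt e = (\<lambda>q\<in>{0..t}. card {k. k \<le> p \<and> e k \<le> q})" for e :: "nat \<Rightarrow> real"
    define h :: "(nat \<Rightarrow> real) \<Rightarrow> ennreal" where "h e = indicator B (cnt e)" for e
    have cnt: "cnt \<in> measurable (PiM {..p} (\<lambda>_. borel)) ?S"
      unfolding cnt_def[abs_def]
    proof (intro measurable_restrict measurable_card)
      fix q :: real and k
      show "{e \<in> space (PiM {..p} (\<lambda>_. borel)). k \<in> {k. k \<le> p \<and> e k \<le> q}} \<in> sets (PiM {..p} (\<lambda>_. borel))"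
      proof (cases "k \<le> p")
        case True
        then have "(\<lambda>e. e k) \<in> borel_measurable (PiM {..p} (\<lambda>_. borel :: real measure))"
          by (intro measurable_component_singleton) simp
        from borel_measurable_le[OF this borel_measurable_const[of q]] True show ?thesis by simp
      qed simp
    qed
    have h: "h \<in> borel_measurable (PiM {..p} (\<lambda>_. borel))"
      unfolding h_def[abs_def] by (rule measurable_compose[OF cnt borel_measurable_indicator[OF B]])
    have restrict: "cnt (\<lambda>k\<in>{..p}. e k) = cnt e" for e
      unfolding cnt_def by (intro restrict_ext arg_cong[where f=card]) auto
    have N_eq: "?N \<omega> = cnt (\<lambda>k. ?e k \<omega>)" and R_eq: "?R \<omega> = cnt (\<lambda>k. t - ?e (p - k) \<omega>)"
      if \<omega>: "\<omega> \<in> space M" and "En i \<omega>" for \<omega>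
    proof -
      have le: "k \<le> p" if "?e k \<omega> \<le> t" for k
      proof (rule ccontr)
        assume "\<not> k \<le> p"
        then have "?e (Suc p) \<omega> \<le> ?e k \<omega>" by (intro mono[OF \<omega>]) simp
        with that \<open>En i \<omega>\<close> show False by (simp add: En_def Suc)
      qed
      have ge: "?e k \<omega> \<le> t" if "k \<le> p" for k
        using mono[OF \<omega> that] \<open>En i \<omega>\<close> by (simp add: En_def Suc)
      show "?N \<omega> = cnt (\<lambda>k. ?e k \<omega>)"
        unfolding cnt_def counting_process_def
        by (intro restrict_ext arg_cong[where f=card]) (auto intro: le)
      show "?R \<omega> = cnt (\<lambda>k. t - ?e (p - k) \<omega>)"
        unfolding cnt_def
      proof (rule restrict_ext)
        fix q
        show "card {k. t - q \<le> ?e k \<omega> \<and> ?e k \<omega> \<le> t} = card {k. k \<le> p \<and> t - ?e (p - k) \<omega> \<le> q}"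
          by (rule bij_betw_same_card[of "\<lambda>k. p - k"], rule bij_betw_byWitness[where f'="\<lambda>k. p - k"])
            (auto dest: le intro: ge)
      qed
    qed
    have "emeasure M {\<omega>\<in>space M. En i \<omega> \<and> ?R \<omega> \<in> B} =
        (\<integral>\<^sup>+\<omega>. indicator {\<omega>\<in>space M. En i \<omega> \<and> ?R \<omega> \<in> B} \<omega> \<partial>M)"
      using pred_sets2[OF B R] by (intro nn_integral_indicator[symmetric]) measurable
    also have "\<dots> = (\<integral>\<^sup>+\<omega>. h (\<lambda>k\<in>{..p}. t - ?e (p - k) \<omega>) *
        indicator {\<omega>. ?e p \<omega> \<le> t \<and> t < ?e (Suc p) \<omega>} \<omega> \<partial>M)"
      using R_eq by (intro nn_integral_cong) (auto simp: h_def restrict En_def Suc indicator_def)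
    also have "\<dots> = (\<integral>\<^sup>+\<omega>. h (\<lambda>k\<in>{..p}. ?e k \<omega>) *
        indicator {\<omega>. ?e p \<omega> \<le> t \<and> t < ?e (Suc p) \<omega>} \<omega> \<partial>M)"
      by (rule epochs_reversed[OF h])
    also have "\<dots> = (\<integral>\<^sup>+\<omega>. indicator {\<omega>\<in>space M. En i \<omega> \<and> ?N \<omega> \<in> B} \<omega> \<partial>M)"
      using N_eq by (intro nn_integral_cong) (auto simp: h_def restrict En_def Suc indicator_def)
    also have "\<dots> = emeasure M {\<omega>\<in>space M. En i \<omega> \<and> ?N \<omega> \<in> B}"
      using pred_sets2[OF B N] by (intro nn_integral_indicator) measurable
    finally show ?thesis by (simp add: emeasure_eq_measure)
  qed
  then have "ennreal (prob {\<omega>\<in>space M. ?R \<omega> \<in> B}) = ennreal (prob {\<omega>\<in>space M. ?N \<omega> \<in> B})"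
    unfolding decompose[OF R] decompose[OF N] by simp
  then show "emeasure (distr M ?S ?R) B = emeasure (distr M ?S ?N) B"
    using R N B by (simp add: emeasure_distr emeasure_eq_measure vimage_def Int_def conj_commute)
qed simp

end

lemma mean_pos:
  fixes X :: "'p \<Rightarrow> real"
  assumes P: "prob_space P" and int: "integrable P X" and nonneg: "AE \<omega> in P. 0 \<le> X \<omega>"
    and zero: "measure P {\<omega>\<in>space P. X \<omega> = 0} = 0"
  shows "AE \<omega> in P. 0 < X \<omega>" and "0 < integral\<^sup>L P X"
proof -
  interpret P: prob_space P by fact
  have X[measurable]: "X \<in> borel_measurable P" using int by simp
  have "AE \<omega> in P. X \<omega> \<noteq> 0"
    using zero by (subst AE_iff_measurable[OF _ refl]) (auto simp: P.emeasure_eq_measure)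
  with nonneg show pos: "AE \<omega> in P. 0 < X \<omega>" by eventually_elim auto
  have "P.expectation (\<lambda>\<omega>. - X \<omega>) < 0"
    using int pos by (intro P.expectation_less) auto
  then show "0 < integral\<^sup>L P X" by simp
qed

lemma equilibrium_renewalI:
  fixes X :: "'p \<Rightarrow> real"
  assumes M: "prob_space M" and P: "prob_space P" and int: "integrable P X" and nonneg: "AE \<omega> in P. 0 \<le> X \<omega>"
    and zero: "measure P {\<omega>\<in>space P. X \<omega> = 0} = 0"
    and T: "equilibrium_interevent_times M T P X"
  shows "equilibrium_renewal M T (distr P borel X) (integral\<^sup>L P X)"
proof -
  interpret M: prob_space M by (rule M)
  have X: "X \<in> borel_measurable P" using int by simp
  show ?thesis
  proof
    show "M.indep_vars (\<lambda>_. borel) T UNIV" using T by (simp add: equilibrium_interevent_times_def)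
    show "0 \<le> T k \<omega>" if "\<omega> \<in> space M" for k \<omega>
      using T that by (simp add: equilibrium_interevent_times_def)
    show "distr M borel (T 0) = equilibrium_law (distr P borel X) (integral\<^sup>L P X)"
      using T by (intro residual_life_law M P int nonneg mean_pos(2)[OF P int nonneg zero])
        (simp add: equilibrium_interevent_times_def)
    show "distr M borel (T (Suc k)) = distr P borel X" for k
      using T by (simp add: equilibrium_interevent_times_def same_law_def)
    show "AE y in distr P borel X. 0 < y"
      using mean_pos(1)[OF P int nonneg zero] X by (simp add: AE_distr_iff)
    show "0 < integral\<^sup>L P X" by (rule mean_pos(2)[OF P int nonneg zero])
  qed
qed

section \<open>The number in system is a measurable function of the primitives\<close>

lemma number_in_system_cong:
  assumes "n \<ge> 1" and v: "\<And>i. i < n \<Longrightarrow> v i = v' i"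
  shows "number_in_system n v a s t = number_in_system n v' a s t"
proof -
  have w: "i < n \<Longrightarrow> free_time n v a s k i = free_time n v' a s k i" for k i
  proof (induction k arbitrary: i)
    case (Suc k)
    have "serving n v a s k = serving n v' a s k" by (rule next_server_cong) (rule Suc.IH)
    then show ?case using Suc.IH[of i] Suc.prems Suc.IH[of "serving n v' a s k"] next_server_min(1)[OF assms(1)]
      by (simp add: Let_def)
  qed (simp add: v)
  have "serving n v a s k = serving n v' a s k" for k by (rule next_server_cong) (rule w)
  then have "start_time n v a s k = start_time n v' a s k" for k
    unfolding start_time_def Let_def using w[OF next_server_min(1)[OF assms(1)], of k] by simp
  moreover have "{i. i < n \<and> t < v i} = {i. i < n \<and> t < v' i}" using v by auto
  ultimately show ?thesis
    unfolding number_in_system_def number_in_service_def number_waiting_def by simp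
qed

lemma number_in_system_measurable:
  assumes n: "n \<ge> 1" and v[measurable]: "\<And>i. i < n \<Longrightarrow> (\<lambda>\<omega>. v \<omega> i) \<in> borel_measurable N"
    and a[measurable]: "\<And>k. (\<lambda>\<omega>. a \<omega> k) \<in> borel_measurable N"
    and s[measurable]: "\<And>k. (\<lambda>\<omega>. s \<omega> k) \<in> borel_measurable N"
  shows "(\<lambda>\<omega>. number_in_system n (v \<omega>) (a \<omega>) (s \<omega>) t) \<in> measurable N (count_space UNIV)"
proof -
  let ?w = "\<lambda>\<omega> k i. free_time n (v \<omega>) (a \<omega>) (s \<omega>) k i"
  let ?p = "\<lambda>\<omega> k. serving n (v \<omega>) (a \<omega>) (s \<omega>) k"
  have w: "i < n \<Longrightarrow> (\<lambda>\<omega>. ?w \<omega> k i) \<in> borel_measurable N" for k i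
  proof (induction k arbitrary: i)
    case (Suc k)
    have [measurable]: "(\<lambda>\<omega>. ?p \<omega> k) \<in> measurable N (count_space UNIV)"
      by (rule measurable_next_server) (rule Suc.IH)
    have [measurable]: "(\<lambda>\<omega>. ?w \<omega> k (?p \<omega> k)) \<in> borel_measurable N"
      by (rule measurable_select[OF _ next_server_min(1)[OF n] Suc.IH]) measurable
    have [measurable]: "(\<lambda>\<omega>. ?w \<omega> k i) \<in> borel_measurable N" by (rule Suc.IH[OF Suc.prems])
    have "(\<lambda>\<omega>. if i = ?p \<omega> k then max (a \<omega> k) (?w \<omega> k (?p \<omega> k)) + s \<omega> k else ?w \<omega> k i) \<in> borel_measurable N"
      by measurable
    then show ?case by (simp add: Let_def fun_upd_def)
  qed simp
  have p: "(\<lambda>\<omega>. ?p \<omega> k) \<in> measurable N (count_space UNIV)" for k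
    by (rule measurable_next_server) (rule w)
  have [measurable]: "(\<lambda>\<omega>. ?w \<omega> k (?p \<omega> k)) \<in> borel_measurable N" for k
    by (rule measurable_select[OF p next_server_min(1)[OF n] w])
  have [measurable]: "(\<lambda>\<omega>. start_time n (v \<omega>) (a \<omega>) (s \<omega>) k) \<in> borel_measurable N" for k
    unfolding start_time_def Let_def by measurable
  have [measurable]: "(\<lambda>\<omega>. card {i. i < n \<and> t < v \<omega> i}) \<in> measurable N (count_space UNIV)"
  proof (rule measurable_card)
    fix i show "{\<omega>\<in>space N. i \<in> {i. i < n \<and> t < v \<omega> i}} \<in> sets N"
      using borel_measurable_less[OF borel_measurable_const[of t] v[of i]] by (cases "i < n") auto
  qed
  have [measurable]: "(\<lambda>\<omega>. card {k. start_time n (v \<omega>) (a \<omega>) (s \<omega>) k \<le> t \<and> t < start_time n (v \<omega>) (a \<omega>) (s \<omega>) k + s \<omega> k})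
      \<in> measurable N (count_space UNIV)"
    "(\<lambda>\<omega>. card {k. a \<omega> k \<le> t \<and> t < start_time n (v \<omega>) (a \<omega>) (s \<omega>) k}) \<in> measurable N (count_space UNIV)"
    by (rule measurable_card, unfold mem_Collect_eq, measurable)+
  show ?thesis
    unfolding number_in_system_def number_in_service_def number_waiting_def by measurable
qed

section \<open>Transfer between probability spaces\<close>

lemma same_joint_law:
  fixes Z :: "'i \<Rightarrow> 'a \<Rightarrow> 'x" and Z' :: "'i \<Rightarrow> 'b \<Rightarrow> 'x"
  assumes M: "prob_space M" and M': "prob_space M'" and J: "J \<noteq> {}"
    and ind: "prob_space.indep_vars M (\<lambda>_. S) Z J" and ind': "prob_space.indep_vars M' (\<lambda>_. S) Z' J"
    and law: "\<And>j. j \<in> J \<Longrightarrow> distr M S (Z j) = distr M' S (Z' j)"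
    and E: "Measurable.pred (PiM J (\<lambda>_. S)) E"
  shows "measure M {\<omega>\<in>space M. E (\<lambda>j\<in>J. Z j \<omega>)} = measure M' {\<omega>\<in>space M'. E (\<lambda>j\<in>J. Z' j \<omega>)}"
proof -
  interpret M: prob_space M by fact
  interpret M': prob_space M' by fact
  have Z: "j \<in> J \<Longrightarrow> Z j \<in> measurable M S" and Z': "j \<in> J \<Longrightarrow> Z' j \<in> measurable M' S" for j
    using ind ind' by (auto simp: M.indep_vars_def M'.indep_vars_def)
  have R: "(\<lambda>\<omega>. \<lambda>j\<in>J. Z j \<omega>) \<in> measurable M (PiM J (\<lambda>_. S))"
    and R': "(\<lambda>\<omega>. \<lambda>j\<in>J. Z' j \<omega>) \<in> measurable M' (PiM J (\<lambda>_. S))"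
    by (intro measurable_restrict Z Z'; assumption)+
  have "distr M (PiM J (\<lambda>_. S)) (\<lambda>\<omega>. \<lambda>j\<in>J. Z j \<omega>) = PiM J (\<lambda>j. distr M S (Z j))"
    using M.indep_vars_iff_distr_eq_PiM'[where I=J and X=Z and M'="\<lambda>_. S"] J Z ind by simp
  also have "\<dots> = PiM J (\<lambda>j. distr M' S (Z' j))" by (rule PiM_cong) (auto simp: law)
  also have "\<dots> = distr M' (PiM J (\<lambda>_. S)) (\<lambda>\<omega>. \<lambda>j\<in>J. Z' j \<omega>)"
    using M'.indep_vars_iff_distr_eq_PiM'[where I=J and X=Z' and M'="\<lambda>_. S"] J Z' ind' by simp
  finally have "measure (distr M (PiM J (\<lambda>_. S)) (\<lambda>\<omega>. \<lambda>j\<in>J. Z j \<omega>)) {z\<in>space (PiM J (\<lambda>_. S)). E z} =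
      measure (distr M' (PiM J (\<lambda>_. S)) (\<lambda>\<omega>. \<lambda>j\<in>J. Z' j \<omega>)) {z\<in>space (PiM J (\<lambda>_. S)). E z}"
    by simp
  then show ?thesis
    using E measurable_space[OF R] measurable_space[OF R']
    by (simp add: measure_distr[OF R] measure_distr[OF R'] pred_def vimage_def Int_def conj_commute cong: conj_cong)
qed

section \<open>Suprema over rational times\<close>

text \<open>This holds on every path: if infinitely many events happen by time \<open>s\<close>, the count is \<open>0\<close> from
  \<open>s\<close> on.\<close>

lemma counting_process_right_constant:
  assumes "\<And>k. 0 \<le> T k \<omega>"
  shows "eventually (\<lambda>u. counting_process T u \<omega> = counting_process T s \<omega>) (at_right s)"
proof (cases "\<exists>k. s < event_time T k \<omega>")
  case True
  let ?k = "LEAST k. s < event_time T k \<omega>"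
  have k: "s < event_time T ?k \<omega>" by (rule LeastI_ex[OF True])
  have before: "event_time T j \<omega> \<le> s" if "j < ?k" for j using not_less_Least[OF that] by simp
  have eq: "{j. event_time T j \<omega> \<le> u} = {..<?k}" if "s \<le> u" "u < event_time T ?k \<omega>" for u
  proof -
    have "j < ?k" if "event_time T j \<omega> \<le> u" for j
    proof (rule ccontr)
      assume "\<not> j < ?k"
      then have "event_time T ?k \<omega> \<le> event_time T j \<omega>" by (intro event_time_mono assms) simp
      with that \<open>u < event_time T ?k \<omega>\<close> show False by simp
    qed
    moreover have "event_time T j \<omega> \<le> u" if "j < ?k" for j using before[OF that] \<open>s \<le> u\<close> by simp
    ultimately show ?thesis by auto
  qed
  have "eventually (\<lambda>u. u < event_time T ?k \<omega>) (at_right s)"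
    using k by (auto simp: eventually_at_right[OF k])
  moreover have "eventually (\<lambda>u. s < u) (at_right s)" by (rule eventually_at_right_less)
  ultimately show ?thesis
    by eventually_elim (simp add: counting_process_def eq k)
next
  case False
  then have "event_time T j \<omega> \<le> s" for j by (simp add: not_less)
  then have "{j. event_time T j \<omega> \<le> u} = UNIV" if "s \<le> u" for u using that by (auto intro: order_trans)
  moreover have "eventually (\<lambda>u. s < u) (at_right s)" by (rule eventually_at_right_less)
  ultimately show ?thesis by (auto simp: counting_process_def elim: eventually_mono)
qed

lemma difference_exceeds_at_rational:
  assumes X: "\<And>k. 0 \<le> X k \<omega>" and Y: "\<And>i k. i < n \<Longrightarrow> 0 \<le> Y i k \<omega>"
    and s: "x < renewal_difference n X Y s \<omega>" and "s < b"
  shows "\<exists>q\<in>\<rat>. s < q \<and> q < b \<and> x < renewal_difference n X Y q \<omega>"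
proof -
  have "eventually (\<lambda>u. \<forall>i\<in>{..<n}. counting_process (Y i) u \<omega> = counting_process (Y i) s \<omega>) (at_right s)"
    by (intro eventually_ball_finite) (auto intro: counting_process_right_constant Y)
  with counting_process_right_constant[where T=X and \<omega>=\<omega> and s=s, OF X]
  have "eventually (\<lambda>u. renewal_difference n X Y u \<omega> = renewal_difference n X Y s \<omega>) (at_right s)"
    by eventually_elim (simp add: renewal_difference_def)
  then obtain c where c: "s < c" "\<And>u. s < u \<Longrightarrow> u < c \<Longrightarrow> renewal_difference n X Y u \<omega> = renewal_difference n X Y s \<omega>"
    using \<open>s < b\<close> by (auto simp: eventually_at_right[OF \<open>s < b\<close>])
  obtain q where "q \<in> \<rat>" "s < q" "q < min b c" using Rats_dense_in_real[of s "min b c"] c \<open>s < b\<close> by auto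
  with c s show ?thesis by auto
qed

text \<open>The supremum over \<open>I\<close> may be restricted to a subset \<open>J\<close> that contains rational times
  immediately after each missing time.\<close>

lemma sup_difference_exceeds_iff:
  assumes X: "\<And>k. 0 \<le> X k \<omega>" and Y: "\<And>i k. i < n \<Longrightarrow> 0 \<le> Y i k \<omega>" and "J \<subseteq> I"
    and dense: "\<And>s. s \<in> I - J \<Longrightarrow> \<exists>b>s. \<rat> \<inter> {s<..<b} \<subseteq> J"
  shows "ereal x < (SUP s\<in>I. ereal (renewal_difference n X Y s \<omega>)) \<longleftrightarrow>
    (\<exists>q\<in>J. x < renewal_difference n X Y q \<omega>)"
proof -
  have "\<exists>q\<in>J. x < renewal_difference n X Y q \<omega>"
    if s: "s \<in> I - J" and xs: "x < renewal_difference n X Y s \<omega>" for s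
  proof -
    obtain b where b: "s < b" "\<rat> \<inter> {s<..<b} \<subseteq> J" using dense[OF s] by blast
    obtain q where "q \<in> \<rat>" "s < q" "q < b" "x < renewal_difference n X Y q \<omega>"
      using difference_exceeds_at_rational[where X=X and Y=Y and \<omega>=\<omega> and x=x, OF X Y xs b(1)] by blast
    then show ?thesis using b by auto
  qed
  then have "(\<exists>s\<in>I. x < renewal_difference n X Y s \<omega>) \<longleftrightarrow> (\<exists>q\<in>J. x < renewal_difference n X Y q \<omega>)"
    using \<open>J \<subseteq> I\<close> by blast
  then show ?thesis by (simp add: less_SUP_iff)
qed

section \<open>Time reversal of the difference of renewal processes\<close>

lemma indep_sequences:
  fixes X :: "nat \<Rightarrow> 'a \<Rightarrow> real" and Y :: "nat \<Rightarrow> nat \<Rightarrow> 'a \<Rightarrow> real"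
  assumes M: "prob_space M"
    and ind: "prob_space.indep_vars M (\<lambda>_. borel) (case_sum X (\<lambda>(i, k). Y i k)) (UNIV <+> ({..<n} \<times> UNIV))"
  shows "prob_space.indep_vars M (\<lambda>_. PiM UNIV (\<lambda>_. borel))
    (\<lambda>j \<omega>. case j of None \<Rightarrow> (\<lambda>k. X k \<omega>) | Some i \<Rightarrow> (\<lambda>k. Y i k \<omega>)) (insert None (Some ` {..<n}))"
proof -
  interpret prob_space M by (rule M)
  let ?K = "\<lambda>j. case j of None \<Rightarrow> range (Inl :: nat \<Rightarrow> nat + nat \<times> nat) | Some i \<Rightarrow> Inr ` ({i} \<times> UNIV)"
  let ?J = "insert None (Some ` {..<n})"
  let ?f = "\<lambda>j w k. case j of None \<Rightarrow> w (Inl k) | Some i \<Rightarrow> w (Inr (i, k))"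
  have "indep_vars (\<lambda>j. PiM (?K j) (\<lambda>_. borel)) (\<lambda>j \<omega>. restrict (\<lambda>i. case_sum X (\<lambda>(i, k). Y i k) i \<omega>) (?K j)) ?J"
    by (rule indep_vars_restrict[OF ind]) (auto simp: disjoint_family_on_def)
  moreover have "?f j \<in> measurable (PiM (?K j) (\<lambda>_. borel)) (PiM UNIV (\<lambda>_. borel))" if "j \<in> ?J" for j
  proof -
    have "(\<lambda>w. \<lambda>k\<in>UNIV. ?f j w k) \<in> measurable (PiM (?K j) (\<lambda>_. borel)) (PiM UNIV (\<lambda>_. borel))"
      by (rule measurable_restrict) (auto split: option.split intro!: measurable_component_singleton)
    then show ?thesis unfolding restrict_UNIV .
  qed
  ultimately have "indep_vars (\<lambda>_. PiM UNIV (\<lambda>_. borel))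
      (\<lambda>j \<omega>. ?f j (restrict (\<lambda>i. case_sum X (\<lambda>(i, k). Y i k) i \<omega>) (?K j))) ?J"
    by (rule indep_vars_compose2)
  then show ?thesis
    by (rule indep_vars_cong[THEN iffD1, rotated -1]) (auto simp: fun_eq_iff split: option.split)
qed

text \<open>The \<open>n + 1\<close> processes are reversed one by one, which preserves their joint law because
  they are independent.\<close>

lemma renewal_difference_reversed:
  assumes M: "prob_space M" and X: "equilibrium_renewal M X DX mX"
    and Y: "\<And>i. i < n \<Longrightarrow> equilibrium_renewal M (Y i) DY mY"
    and ind: "prob_space.indep_vars M (\<lambda>_. borel) (case_sum X (\<lambda>(i, k). Y i k)) (UNIV <+> ({..<n} \<times> UNIV))"
    and Q: "countable Q" "Q \<subseteq> {0..t}"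
  defines "R \<equiv> \<lambda>T q \<omega>. card {k. t - q \<le> event_time T k \<omega> \<and> event_time T k \<omega> \<le> t}"
  shows "measure M {\<omega>\<in>space M. \<exists>q\<in>Q. x < real (R X q \<omega>) - (\<Sum>i<n. real (R (Y i) q \<omega>))} =
    measure M {\<omega>\<in>space M. \<exists>q\<in>Q. x < renewal_difference n X Y q \<omega>}"
proof -
  interpret prob_space M by (rule M)
  let ?J = "insert None (Some ` {..<n})" and ?S = "PiM {0..t} (\<lambda>_. count_space (UNIV :: nat set))"
  let ?P = "PiM UNIV (\<lambda>_::nat. borel :: real measure)"
  let ?T = "\<lambda>j. case j of None \<Rightarrow> X | Some i \<Rightarrow> Y i"
  let ?N = "\<lambda>j \<omega>. \<lambda>q\<in>{0..t}. counting_process (?T j) q \<omega>" and ?R = "\<lambda>j \<omega>. \<lambda>q\<in>{0..t}. R (?T j) q \<omega>"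
  let ?E = "\<lambda>f. \<exists>q\<in>Q. x < real (f None q) - (\<Sum>i<n. real (f (Some i) q))"
  let ?e = "\<lambda>\<tau> k. \<Sum>j\<le>k. \<tau> j :: real"
  have e[measurable]: "(\<lambda>\<tau>. ?e \<tau> k) \<in> borel_measurable ?P" for k
    by (intro borel_measurable_sum measurable_component_singleton) auto
  note seq = indep_sequences[OF M ind]
  have split: "(\<lambda>k. ?T j k \<omega>) = (case j of None \<Rightarrow> (\<lambda>k. X k \<omega>) | Some i \<Rightarrow> (\<lambda>k. Y i k \<omega>))" for j \<omega>
    by (auto split: option.split)
  have "(\<lambda>\<tau>. \<lambda>q\<in>{0..t}. card {k. ?e \<tau> k \<le> q}) \<in> measurable ?P ?S"
    by (intro measurable_restrict measurable_card) measurable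
  from indep_vars_compose2[OF seq this]
  have N: "indep_vars (\<lambda>_. ?S) ?N ?J"
    unfolding split[symmetric] counting_process_def event_time_def .
  have "(\<lambda>\<tau>. \<lambda>q\<in>{0..t}. card {k. t - q \<le> ?e \<tau> k \<and> ?e \<tau> k \<le> t}) \<in> measurable ?P ?S"
    by (intro measurable_restrict measurable_card) measurable
  from indep_vars_compose2[OF seq this]
  have R: "indep_vars (\<lambda>_. ?S) ?R ?J"
    unfolding split[symmetric] R_def event_time_def .
  have same: "distr M ?S (?R j) = distr M ?S (?N j)" if "j \<in> ?J" for j
  proof -
    have "equilibrium_renewal M (?T j) (case j of None \<Rightarrow> DX | Some i \<Rightarrow> DY) (case j of None \<Rightarrow> mX | Some i \<Rightarrow> mY)"
      using that X Y by (cases j) auto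
    from equilibrium_renewal.counts_reversed[OF this] show ?thesis unfolding R_def .
  qed
  have coord: "(\<lambda>f. real (f j q)) \<in> borel_measurable (PiM ?J (\<lambda>_. ?S))" if "j \<in> ?J" "q \<in> {0..t}" for j q
  proof -
    have j: "(\<lambda>f. f j) \<in> measurable (PiM ?J (\<lambda>_. ?S)) ?S"
      by (rule measurable_component_singleton) (rule that(1))
    have q: "(\<lambda>g. g q) \<in> measurable ?S (count_space UNIV)"
      by (rule measurable_component_singleton) (rule that(2))
    show ?thesis by (rule measurable_compose[OF measurable_compose[OF j q]]) simp
  qed
  have E: "Measurable.pred (PiM ?J (\<lambda>_. ?S)) ?E"
    unfolding pred_def
  proof (rule sets.sets_Collect_countable_Ex'[OF _ Q(1)])
    fix q assume "q \<in> Q"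
    then have q: "q \<in> {0..t}" using Q by auto
    show "{f \<in> space (PiM ?J (\<lambda>_. ?S)). x < real (f None q) - (\<Sum>i<n. real (f (Some i) q))} \<in> sets (PiM ?J (\<lambda>_. ?S))"
      by (intro borel_measurable_less borel_measurable_const borel_measurable_diff borel_measurable_sum coord q) auto
  qed
  have "measure M {\<omega>\<in>space M. ?E (\<lambda>j\<in>?J. ?R j \<omega>)} = measure M {\<omega>\<in>space M. ?E (\<lambda>j\<in>?J. ?N j \<omega>)}"
    by (rule same_joint_law[OF M M _ R N same E]) auto
  moreover have "?E (\<lambda>j\<in>?J. ?R j \<omega>) \<longleftrightarrow> (\<exists>q\<in>Q. x < real (R X q \<omega>) - (\<Sum>i<n. real (R (Y i) q \<omega>)))" for \<omega>
    using Q by (intro bex_cong refl) (auto simp: subset_iff)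
  moreover have "?E (\<lambda>j\<in>?J. ?N j \<omega>) \<longleftrightarrow> (\<exists>q\<in>Q. x < renewal_difference n X Y q \<omega>)" for \<omega>
    using Q by (intro bex_cong refl) (auto simp: subset_iff renewal_difference_def)
  ultimately show ?thesis by simp
qed

section \<open>Tail bounds pass to weak limits\<close>

text \<open>The bound holds at the continuity points of \<open>cdf \<pi>\<close> above \<open>c\<close>. These accumulate at \<open>c\<close>,
  because a finite measure has countably many atoms, and \<open>cdf \<pi>\<close> is right-continuous at \<open>c\<close>.\<close>

lemma weak_limit_tail_le:
  fixes Z :: "real \<Rightarrow> 'a \<Rightarrow> real"
  assumes M: "prob_space M" and \<pi>: "real_distribution \<pi>"
    and conv: "weak_conv_at_top (\<lambda>t. distr M borel (Z t)) \<pi>"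
    and Z: "\<And>t. Z t \<in> borel_measurable M"
    and tail: "\<And>y t. c < y \<Longrightarrow> 0 \<le> t \<Longrightarrow> measure M {\<omega>\<in>space M. y < Z t \<omega>} \<le> b"
  shows "measure \<pi> {c<..} \<le> b"
proof -
  interpret M: prob_space M by (rule M)
  interpret \<pi>: real_distribution \<pi> by (rule \<pi>)
  have cont: "1 - b \<le> cdf \<pi> y" if y: "c < y" "isCont (cdf \<pi>) y" for y
  proof (rule tendsto_lowerbound)
    show "((\<lambda>t. cdf (distr M borel (Z t)) y) \<longlongrightarrow> cdf \<pi> y) at_top"
      using conv y(2) unfolding weak_conv_at_top_def by blast
    show "\<forall>\<^sub>F t in at_top. 1 - b \<le> cdf (distr M borel (Z t)) y"
      using eventually_ge_at_top[of 0]
    proof eventually_elim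
      case (elim t)
      note [measurable] = Z[of t]
      have "cdf (distr M borel (Z t)) y = measure M {\<omega>\<in>space M. \<not> y < Z t \<omega>}"
        unfolding cdf_def by (subst measure_distr) (auto intro!: arg_cong[where f="measure M"])
      also have "\<dots> = 1 - measure M {\<omega>\<in>space M. y < Z t \<omega>}"
        by (rule M.prob_neg) measurable
      finally show ?case using tail[OF y(1) elim] by simp
    qed
  qed simp
  have "1 - b \<le> cdf \<pi> c"
  proof (rule ccontr)
    assume less: "\<not> ?thesis"
    have "((cdf \<pi>) \<longlongrightarrow> cdf \<pi> c) (at_right c)"
      using \<pi>.cdf_is_right_cont[of c] by (simp add: continuous_within)
    then have "eventually (\<lambda>y. cdf \<pi> y < 1 - b) (at_right c)"
      using less by (intro order_tendstoD) auto
    then obtain d where d: "c < d" "\<And>y. c < y \<Longrightarrow> y < d \<Longrightarrow> cdf \<pi> y < 1 - b"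
      unfolding eventually_at_right_field by blast
    have "uncountable ({c<..<d} - {y. measure \<pi> {y} \<noteq> 0})"
      using d(1) \<pi>.countable_support
      by (intro uncountable_minus_countable) (auto simp: uncountable_open_interval)
    then have "{c<..<d} - {y. measure \<pi> {y} \<noteq> 0} \<noteq> {}"
      using countable_empty by force
    then obtain y where "c < y" "y < d" "measure \<pi> {y} = 0" by auto
    with d(2)[of y] cont[of y] \<pi>.isCont_cdf[of y] show False by auto
  qed
  moreover have "measure \<pi> {c<..} = 1 - cdf \<pi> c"
  proof -
    have "{c<..} = space \<pi> - {..c}" by auto
    then show ?thesis unfolding cdf_def by (simp only:) (rule \<pi>.prob_compl, simp)
  qed
  ultimately show ?thesis by simp
qed

section \<open>The bound\<close>

theorem theorem3:
  fixes n :: nat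
    and P :: "'p measure" and A S :: "'p \<Rightarrow> real"
    and M :: "'a measure" and T V U :: "nat \<Rightarrow> 'a \<Rightarrow> real"
    and M' :: "'b measure" and X :: "nat \<Rightarrow> 'b \<Rightarrow> real" and Y :: "nat \<Rightarrow> nat \<Rightarrow> 'b \<Rightarrow> real"
  assumes "n \<ge> 1"
    and "prob_space P" and "prob_space M" and "prob_space M'"
    and "integrable P A" and "AE \<omega> in P. A \<omega> \<ge> 0" and "measure P {\<omega> \<in> space P. A \<omega> = 0} = 0"
    and "integrable P S" and "AE \<omega> in P. S \<omega> \<ge> 0" and "measure P {\<omega> \<in> space P. S \<omega> = 0} = 0"
    and "GI_GI_n_primitives n P A S M T V U"
    and "independent_equilibrium_renewals n P A S M' X Y"
  shows "(\<forall>x>0. \<forall>t\<ge>0.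
            measure M {\<omega> \<in> space M. max (real (queue_process n T V U t \<omega>) - real n) 0 > x}
            \<le> measure M' {\<omega> \<in> space M'.
                 (SUP s\<in>{0..t}. ereal (renewal_difference n X Y s \<omega>)) > ereal x})
       \<and> (\<forall>\<pi>. real_distribution \<pi> \<longrightarrow>
            weak_conv_at_top (\<lambda>t. distr M borel (\<lambda>\<omega>. real (queue_process n T V U t \<omega>))) \<pi> \<longrightarrow>
            (\<forall>x>0.
               measure \<pi> {q. max (q - real n) 0 > x}
               \<le> measure M' {\<omega> \<in> space M'.
                    (SUP t\<in>{0..}. ereal (renewal_difference n X Y t \<omega>)) > ereal x}))"
proof -
  note n = assms(1) and P = assms(2) and M = assms(3) and M' = assms(4)
  note prims = assms(11)[unfolded GI_GI_n_primitives_def]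
    and renewals = assms(12)[unfolded independent_equilibrium_renewals_def]
  interpret M: prob_space M by (rule M)
  interpret M': prob_space M' by (rule M')
  let ?DA = "distr P borel A" and ?DS = "distr P borel S"
  have T: "equilibrium_interevent_times M T P A" using prims by simp
  have X: "equilibrium_renewal M' X ?DA (integral\<^sup>L P A)"
    using renewals by (intro equilibrium_renewalI M' P assms(5-7)) simp
  have Y: "equilibrium_renewal M' (Y i) ?DS (integral\<^sup>L P S)" if "i < n" for i
    using renewals that by (intro equilibrium_renewalI M' P assms(8-10)) simp
  have ind: "M'.indep_vars (\<lambda>_. borel) (case_sum X (\<lambda>(i, k). Y i k)) (UNIV <+> ({..<n} \<times> UNIV))"
    using renewals by simp
  have X_nonneg: "0 \<le> X k \<omega>" if "\<omega> \<in> space M'" for k \<omega>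
    using X that by (rule equilibrium_renewal.nonneg)
  have Y_nonneg: "0 \<le> Y i k \<omega>" if "\<omega> \<in> space M'" "i < n" for i k \<omega>
    using Y[OF that(2)] that(1) by (rule equilibrium_renewal.nonneg)
  let ?a = "\<lambda>\<omega> k. event_time X k \<omega>" and ?y = "\<lambda>\<omega> i l. Y i l \<omega>"
  have epoch_eq: "epoch (?y \<omega>) i m = event_time (Y i) m \<omega>" for \<omega> i m
    unfolding epoch_def event_time_def ..
  have merged: "AE \<omega> in M'. merged_paths n (?y \<omega>) (?a \<omega>)"
  proof -
    have "AE \<omega> in M'. \<forall>i\<in>{..<n}. \<forall>t. \<exists>k. t < event_time (Y i) k \<omega>"
      by (rule AE_finite_allI) (auto intro: equilibrium_renewal.unbounded[OF Y])
    with equilibrium_renewal.unbounded[OF X] AE_space show ?thesis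
    proof eventually_elim
      case (elim \<omega>)
      show ?case
      proof
        show "0 \<le> ?a \<omega> k" for k
          unfolding event_time_def using X_nonneg elim by (intro sum_nonneg) auto
        show "?a \<omega> j \<le> ?a \<omega> k" if "j \<le> k" for j k
          by (intro event_time_mono that X_nonneg) (use elim in auto)
      qed (use elim n Y_nonneg in \<open>auto simp: epoch_eq\<close>)
    qed
  qed
  interpret rs: renewal_services M' n X Y ?DS
  proof
    show "AE \<omega> in M'. \<forall>k. \<exists>r. starts_at n (?a \<omega>) (?y \<omega>) k r"
      using merged by eventually_elim (blast dest: merged_paths.starts_at_job_slot)
    show "distr M' borel (Y i (Suc k)) = ?DS" if "i < n" for i k
      using Y[OF that] by (rule equilibrium_renewal.law)
  qed (use n ind in auto)
  \<comment> \<open>\<open>?Z\<close> and \<open>?W\<close> are the primitives of the given queue and of the queue built from the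
    renewal processes. Both families are independent, with the same marginal laws.\<close>
  let ?J = "UNIV <+> ({..<n} <+> UNIV) :: (nat + (nat + nat)) set"
  let ?W = "case_sum X (case_sum (\<lambda>i. Y i 0) (\<lambda>k \<omega>. job_service n (?a \<omega>) (?y \<omega>) k))"
  let ?Z = "case_sum T (case_sum V U)"
  have Z_ind: "M.indep_vars (\<lambda>_. borel) ?Z ?J" using prims by simp
  have Z: "?Z j \<in> borel_measurable M" if "j \<in> ?J" for j
    using Z_ind that unfolding M.indep_vars_def by blast
  have law: "distr M borel (?Z j) = distr M' borel (?W j)" if j: "j \<in> ?J" for j
  proof -
    have first: "distr M borel R = equilibrium_law ?DS (integral\<^sup>L P S)" if "residual_life M R P S" for R
      by (rule residual_life_law[OF M P assms(8,9) mean_pos(2)[OF P assms(8-10)] that])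
    have T_eq: "equilibrium_renewal M T ?DA (integral\<^sup>L P A)"
      by (rule equilibrium_renewalI[OF M P assms(5-7) T])
    consider k where "j = Inl k" | i where "j = Inr (Inl i)" "i < n" | k where "j = Inr (Inr k)"
      using j by auto
    then show ?thesis
    proof cases
      case 1
      then show ?thesis
        using equilibrium_renewal.first_law[OF T_eq] equilibrium_renewal.law[OF T_eq, of "k - 1"]
          equilibrium_renewal.first_law[OF X] equilibrium_renewal.law[OF X, of "k - 1"]
        by (cases k) auto
    next
      case 2
      then show ?thesis
        using first[of "V i"] equilibrium_renewal.first_law[OF Y, of i] prims by simp
    next
      case 3
      then show ?thesis
        using prims rs.U_law[of k] by (simp add: same_law_def)
    qed
  qed
  let ?Q = "\<lambda>z t. number_in_system n (\<lambda>i. z (Inr (Inl i))) (\<lambda>k. \<Sum>j\<le>k. z (Inl j)) (\<lambda>k. z (Inr (Inr k))) t"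
  have Q_meas: "(\<lambda>z. ?Q z t) \<in> measurable (PiM ?J (\<lambda>_. borel)) (count_space UNIV)" for t
    by (rule number_in_system_measurable[OF n])
      (auto intro!: borel_measurable_sum measurable_component_singleton)
  have Q_restrict: "?Q (\<lambda>j\<in>?J. Z j) t = ?Q Z t" for Z :: "nat + (nat + nat) \<Rightarrow> real" and t
  proof -
    have mem: "Inl k \<in> ?J" "Inr (Inr k) \<in> ?J" for k by auto
    have "?Q (\<lambda>j\<in>?J. Z j) t = number_in_system n (\<lambda>i. (\<lambda>j\<in>?J. Z j) (Inr (Inl i))) (\<lambda>k. \<Sum>j\<le>k. Z (Inl j)) (\<lambda>k. Z (Inr (Inr k))) t"
      by (simp add: mem)
    also have "\<dots> = ?Q Z t" by (rule number_in_system_cong[OF n]) auto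
    finally show ?thesis .
  qed
  let ?Q' = "\<lambda>t \<omega>. number_in_system n (\<lambda>i. ?y \<omega> i 0) (?a \<omega>) (job_service n (?a \<omega>) (?y \<omega>)) t"
  have Q_eq: "?Q (\<lambda>j. ?Z j \<omega>) t = queue_process n T V U t \<omega>" for t \<omega>
    unfolding queue_process_def event_time_def by simp
  have Q'_eq: "?Q (\<lambda>j. ?W j \<omega>) t = ?Q' t \<omega>" for t \<omega>
    unfolding event_time_def by simp
  have transfer: "measure M {\<omega>\<in>space M. x < max (real (queue_process n T V U t \<omega>) - real n) 0} =
      measure M' {\<omega>\<in>space M'. x < max (real (?Q' t \<omega>) - real n) 0}" for x t
  proof -
    have "Measurable.pred (PiM ?J (\<lambda>_. borel)) (\<lambda>z. x < max (real (?Q z t) - real n) 0)"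
      by (rule measurable_compose[OF Q_meas]) simp
    from same_joint_law[OF M M' _ Z_ind rs.indep_primitives law this]
    show ?thesis unfolding Q_restrict Q_eq Q'_eq by auto
  qed
  have queue_meas: "(\<lambda>\<omega>. queue_process n T V U t \<omega>) \<in> measurable M (count_space UNIV)" for t
    unfolding queue_process_def
  proof (rule number_in_system_measurable[OF n])
    show "(\<lambda>\<omega>. V i \<omega>) \<in> borel_measurable M" if "i < n" for i
      using Z[of "Inr (Inl i)"] that by auto
    show "(\<lambda>\<omega>. event_time T k \<omega>) \<in> borel_measurable M" for k
      unfolding event_time_def using Z[of "Inl _"] by (intro borel_measurable_sum) auto
    show "(\<lambda>\<omega>. U k \<omega>) \<in> borel_measurable M" for k
      using Z[of "Inr (Inr k)"] by auto
  qed
  have event_meas[measurable]: "event_time X k \<in> borel_measurable M'"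
    "i < n \<Longrightarrow> event_time (Y i) k \<in> borel_measurable M'" for i k
    using equilibrium_renewal.event_time_measurable X Y by blast+
  have diff_meas[measurable]: "(\<lambda>\<omega>. renewal_difference n X Y q \<omega>) \<in> borel_measurable M'" for q
  proof -
    have count: "(\<lambda>\<omega>. real (counting_process T q \<omega>)) \<in> borel_measurable M'"
      if [measurable]: "\<And>k. event_time T k \<in> borel_measurable M'" for T
      unfolding counting_process_def
      by (rule measurable_compose[OF measurable_card]) measurable
    show ?thesis
      unfolding renewal_difference_def
      by (intro borel_measurable_diff borel_measurable_sum count event_meas) auto
  qed
  have part1: "measure M {\<omega> \<in> space M. max (real (queue_process n T V U t \<omega>) - real n) 0 > x}
            \<le> measure M' {\<omega> \<in> space M'.
                 (SUP s\<in>{0..t}. ereal (renewal_difference n X Y s \<omega>)) > ereal x}"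
    if x: "0 < x" and t: "0 \<le> t" for x t
  proof -
    let ?G = "{q. (q = t \<or> q \<in> \<rat>) \<and> 0 \<le> q \<and> q \<le> t}"
    have G: "countable ?G" "?G \<subseteq> {0..t}"
      by (rule countable_subset[of _ "insert t \<rat>"]) (auto simp: countable_rat)
    let ?R = "\<lambda>T q \<omega>. card {k. t - q \<le> event_time T k \<omega> \<and> event_time T k \<omega> \<le> t}"
    let ?D = "\<lambda>q \<omega>. real (?R X q \<omega>) - (\<Sum>i<n. real (?R (Y i) q \<omega>))"
    have "measure M {\<omega>\<in>space M. x < max (real (queue_process n T V U t \<omega>) - real n) 0} =
      measure M' {\<omega>\<in>space M'. x < max (real (?Q' t \<omega>) - real n) 0}" by (rule transfer)
    also have "\<dots> \<le> measure M' {\<omega>\<in>space M'. \<exists>q\<in>?G. x < ?D q \<omega>}"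
    proof (rule M'.finite_measure_mono_AE)
      show "AE \<omega> in M'. \<omega> \<in> {\<omega>\<in>space M'. x < max (real (?Q' t \<omega>) - real n) 0} \<longrightarrow> \<omega> \<in> {\<omega>\<in>space M'. \<exists>q\<in>?G. x < ?D q \<omega>}"
        using merged
      proof eventually_elim
        case (elim \<omega>)
        show ?case
          using merged_paths.excess_bound[OF elim x, of t] x by (auto simp: epoch_eq)
      qed
      show "{\<omega>\<in>space M'. \<exists>q\<in>?G. x < ?D q \<omega>} \<in> sets M'"
      proof (rule sets.sets_Collect_countable_Ex'[OF _ G(1)])
        fix q
        have count: "(\<lambda>\<omega>. real (?R T q \<omega>)) \<in> borel_measurable M'"
          if [measurable]: "\<And>k. event_time T k \<in> borel_measurable M'" for T
          by (rule measurable_compose[OF measurable_card]) measurable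
        show "{\<omega>\<in>space M'. x < ?D q \<omega>} \<in> sets M'"
          by (intro borel_measurable_less borel_measurable_const borel_measurable_diff borel_measurable_sum count event_meas) auto
      qed
    qed
    also have "\<dots> = measure M' {\<omega>\<in>space M'. \<exists>q\<in>?G. x < renewal_difference n X Y q \<omega>}"
      by (rule renewal_difference_reversed[OF M' X Y ind G])
    also have "{\<omega>\<in>space M'. \<exists>q\<in>?G. x < renewal_difference n X Y q \<omega>} =
        {\<omega> \<in> space M'. (SUP s\<in>{0..t}. ereal (renewal_difference n X Y s \<omega>)) > ereal x}"
    proof (intro Collect_cong conj_cong refl sup_difference_exceeds_iff[symmetric] X_nonneg Y_nonneg)
      fix s assume "s \<in> {0..t} - ?G"
      then show "\<exists>b>s. \<rat> \<inter> {s<..<b} \<subseteq> ?G" by (intro exI[of _ t]) auto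
    qed auto
    finally show ?thesis .
  qed
  have part2: "measure \<pi> {q. max (q - real n) 0 > x}
               \<le> measure M' {\<omega> \<in> space M'.
                    (SUP t\<in>{0..}. ereal (renewal_difference n X Y t \<omega>)) > ereal x}"
      (is "_ \<le> measure M' ?B")
    if \<pi>: "real_distribution \<pi>"
      and conv: "weak_conv_at_top (\<lambda>t. distr M borel (\<lambda>\<omega>. real (queue_process n T V U t \<omega>))) \<pi>"
      and x: "0 < x" for \<pi> x
  proof -
    let ?Qt = "\<lambda>t \<omega>. real (queue_process n T V U t \<omega>)"
    have "?B = {\<omega>\<in>space M'. \<exists>q\<in>\<rat> \<inter> {0..}. x < renewal_difference n X Y q \<omega>}"
    proof (intro Collect_cong conj_cong refl sup_difference_exceeds_iff X_nonneg Y_nonneg)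
      fix s :: real assume "s \<in> {0..} - \<rat> \<inter> {0..}"
      then show "\<exists>b>s. \<rat> \<inter> {s<..<b} \<subseteq> \<rat> \<inter> {0..}" by (intro exI[of _ "s + 1"]) auto
    qed auto
    also have "\<dots> \<in> sets M'"
      by (rule sets.sets_Collect_countable_Ex') (auto simp: countable_rat)
    finally have B: "?B \<in> sets M'" .
    \<comment> \<open>A level strictly above \<open>n + x\<close> still exceeds \<open>n\<close>, so the positive part can be dropped.\<close>
    have tail: "measure M {\<omega>\<in>space M. y < ?Qt t \<omega>} \<le> measure M' ?B"
      if "real n + x < y" "0 \<le> t" for y t
    proof -
      have "measure M {\<omega>\<in>space M. y < ?Qt t \<omega>} = measure M {\<omega>\<in>space M. max (?Qt t \<omega> - real n) 0 > y - real n}"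
        using that x by (intro arg_cong[where f="measure M"]) auto
      also have "\<dots> \<le> measure M' {\<omega> \<in> space M'. (SUP s\<in>{0..t}. ereal (renewal_difference n X Y s \<omega>)) > ereal (y - real n)}"
        using that x by (intro part1) auto
      also have "\<dots> \<le> measure M' ?B"
      proof (rule M'.finite_measure_mono[OF _ B], intro Collect_mono impI conjI)
        fix \<omega> assume \<omega>: "\<omega> \<in> space M' \<and> ereal (y - real n) < (SUP s\<in>{0..t}. ereal (renewal_difference n X Y s \<omega>))"
        then obtain s where "0 \<le> s" "y - real n < renewal_difference n X Y s \<omega>" by (auto simp: less_SUP_iff)
        then show "ereal x < (SUP t\<in>{0..}. ereal (renewal_difference n X Y t \<omega>))"
          using that by (auto simp: less_SUP_iff intro!: bexI[of _ s])
      qed simp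
      finally show ?thesis .
    qed
    have "{q. max (q - real n) 0 > x} = {real n + x<..}" using x by auto
    moreover have "measure \<pi> {real n + x<..} \<le> measure M' ?B"
      by (rule weak_limit_tail_le[OF M \<pi> conv _ tail])
        (auto intro: measurable_compose[OF queue_meas])
    ultimately show ?thesis by simp
  qed
  from part1 part2 show ?thesis by blast
qed

end
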